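(* Let $a,b,t$ be fixed integers with $3<a\le b$, and let $\tau(b):=2\max\{3,\lceil b/2\rceil\}+1$. If $t\ge\tau(b)$, then $$\operatorname{ex}(n,K_{a,b},K_{3,t})=\Theta_{a,b,t}(n^3),$$ that is, there are constants $c,C>0$ and $n_0$, depending only on $a,b,t$, such that $c\,n^3\le \operatorname{ex}(n,K_{a,b},K_{3,t})\le C\,n^3$ for all $n\ge n_0$.
   Context: For graphs $F$ and $H$, $\operatorname{ex}(n,F,H)$ denotes the maximum number of copies of $F$ (subgraphs isomorphic to $F$, not necessarily induced) in an $n$-vertex $H$-free graph, where a graph is $H$-free if it contains no (not necessarily induced) subgraph isomorphic to $H$. $K_{s,t}$ is the complete bipartite graph with parts of sizes $s$ and $t$. *)

theory Defs
  imports Complex_Main "Graph_Theory.Digraph_Isomorphism" "Graph_Theory.Kuratowski"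
begin

text \<open>
  A finite simple graph is a \<^locale>\<open>pair_graph\<close>: a finite vertex set together with a
  symmetric irreflexive set of arcs on it. An undirected edge \<open>uv\<close> is represented by the
  two arcs \<open>(u,v)\<close> and \<open>(v,u)\<close>.
\<close>

text \<open>
  The copies of \<open>F\<close> in \<open>G\<close> are the subgraphs themselves, not the embeddings.
  If \<open>F\<close> is a graph, then so is each \<open>S\<close> below, being isomorphic to \<open>F\<close>.
\<close>

definition copies :: "'f pair_pre_digraph \<Rightarrow> 'a pair_pre_digraph \<Rightarrow> 'a pair_pre_digraph set" where
  "copies F G = {S. subgraph (with_proj S) (with_proj G) \<and> digraph_iso (with_proj F) (with_proj S)}"

definition free_of :: "'h pair_pre_digraph \<Rightarrow> 'a pair_pre_digraph \<Rightarrow> bool" where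
  "free_of H G \<longleftrightarrow>
     \<not> (\<exists>S. subgraph (with_proj S) (with_proj G) \<and> digraph_iso (with_proj H) (with_proj S))"

text \<open>
  Vertices of the host graphs are natural numbers, which loses nothing: every finite graph is
  isomorphic to one of these. The set below is always finite, and it is nonempty as soon as
  \<open>H\<close> has an edge (see \<open>copy_counts_finite\<close> and \<open>copy_counts_nonempty\<close>), so that
  \<open>Max\<close> is a genuine maximum.
\<close>

definition copy_counts :: "nat \<Rightarrow> 'f pair_pre_digraph \<Rightarrow> 'h pair_pre_digraph \<Rightarrow> nat set" where
  "copy_counts n F H =
     {card (copies F G) | G :: nat pair_pre_digraph.
        pair_graph G \<and> card (pverts G) = n \<and> free_of H G}"

definition gen_turan :: "nat \<Rightarrow> 'f pair_pre_digraph \<Rightarrow> 'h pair_pre_digraph \<Rightarrow> nat" where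
  "gen_turan n F H = Max (copy_counts n F H)"

definition complete_bipartite :: "nat \<Rightarrow> nat \<Rightarrow> nat pair_pre_digraph" where
  "complete_bipartite s t =
     \<lparr> pverts = {0..<s + t},
       parcs = {0..<s} \<times> {s..<s + t} \<union> {s..<s + t} \<times> {0..<s} \<rparr>"

definition tau :: "nat \<Rightarrow> nat" where
  "tau b = 2 * max 3 (nat \<lceil>real b / 2\<rceil>) + 1"

lemma complete_bipartite_is_K: "K\<^bsub>s,t\<^esub> (with_proj (complete_bipartite s t))"
  unfolding complete_bipartite_digraph_pair_def
  by (rule conjI, simp add: complete_bipartite_def,
      rule exI[of _ "{0..<s}"], rule exI[of _ "{s..<s + t}"])
     (auto simp: complete_bipartite_def)

lemma copies_card_le:
  fixes G :: "'a pair_pre_digraph"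
  assumes "pair_graph G"
  shows "finite (copies F G)" "card (copies F G) \<le> 2 ^ card (pverts G) * 2 ^ (card (pverts G) ^ 2)"
proof -
  interpret pair_graph G by fact
  let ?B = "Pow (pverts G) \<times> Pow (pverts G \<times> pverts G)"
  let ?f = "\<lambda>S :: 'a pair_pre_digraph. (pverts S, parcs S)"
  have fin: "finite ?B" by simp
  have inj: "inj_on ?f (copies F G)" by (auto intro!: inj_onI)
  have sub: "?f ` copies F G \<subseteq> ?B"
  proof (rule image_subsetI)
    fix S assume "S \<in> copies F G"
    then have "pverts S \<subseteq> pverts G" "parcs S \<subseteq> parcs G"
      by (simp_all add: copies_def subgraph_def)
    moreover have "parcs G \<subseteq> pverts G \<times> pverts G"
      using wellformed' by auto
    ultimately show "?f S \<in> ?B" by simp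
  qed
  show "finite (copies F G)" using inj sub fin by (meson inj_on_finite)
  have "card (copies F G) \<le> card ?B" using inj sub fin by (rule card_inj_on_le)
  then show "card (copies F G) \<le> 2 ^ card (pverts G) * 2 ^ (card (pverts G) ^ 2)"
    by (simp add: card_cartesian_product card_Pow power2_eq_square)
qed

lemma copy_counts_finite: "finite (copy_counts n F H)"
proof (rule finite_subset)
  show "copy_counts n F H \<subseteq> {..2 ^ n * 2 ^ (n ^ 2)}"
    using copies_card_le(2) unfolding copy_counts_def by blast
qed simp

lemma copy_counts_nonempty:
  assumes "parcs H \<noteq> {}"
  shows "copy_counts n F H \<noteq> {}"
proof -
  let ?G = "\<lparr> pverts = {0..<n}, parcs = {} \<rparr> :: nat pair_pre_digraph"
  have "pair_graph ?G" by unfold_locales (auto simp: symmetric_def)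
  moreover have "free_of H ?G"
    unfolding free_of_def
  proof
    assume "\<exists>S. subgraph (with_proj S) (with_proj ?G) \<and> digraph_iso (with_proj H) (with_proj S)"
    then obtain S :: "nat pair_pre_digraph" and f where "parcs S = {}" and "with_proj S = app_iso f (with_proj H)"
      by (auto simp: subgraph_def digraph_iso_def)
    then have "arcs (app_iso f (with_proj H)) = {}" by (metis with_proj_simps(2))
    then show False using assms by simp
  qed
  ultimately show ?thesis unfolding copy_counts_def by force
qed

end

theory Submission
  imports Defs "HOL-Algebra.Algebraic_Closure_Type" "HOL-Library.Z2"
begin

hide_const (open) Polynomials.degree UnivPoly.coeff UnivPoly.monom

text \<open>
  Upper bound: in a \<open>K\<^sub>3\<^sub>,\<^sub>t\<close>-free graph three vertices of one part of a copy leave boundedly many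
  choices for the other part, and three vertices of that part for the rest of the first.

  Lower bound: put \<open>k = max 3 \<lceil>b/2\<rceil>\<close>, so \<open>b \<le> 2k < t\<close>, and let \<open>K\<close> be the quadratic extension of a
  finite field \<open>F\<close> of order \<open>q = 2^j\<close>, with norm \<open>N\<close> and trace \<open>Tr\<close>. The two vertex classes are
  surfaces \<open>N C = r(A)\<close> in \<open>K \<times> K\<close>, where \<open>r = N \<circ> h + Tr \<circ> g\<close> with \<open>h\<close> a monic polynomial of
  degree \<open>k\<close> without roots in \<open>K\<close> and \<open>g\<close> arbitrary of degree below \<open>k\<close>; the vertices \<open>(A, C)\<close> and
  \<open>(B, D)\<close> are adjacent when \<open>N (A + B) = Tr (C D)\<close>. The common neighbours \<open>(B, D)\<close> of three vertices
  generically lie over a circle in the \<open>B\<close>-plane on which \<open>D\<close> is an affine function of \<open>B\<close>, and in the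
  remaining cases over a line or over at most two points. On a circle the equation \<open>N D = r(B)\<close>
  becomes a Laurent polynomial equation with exponents from \<open>-k\<close> to \<open>k\<close> whose extreme coefficients do
  not vanish because \<open>h\<close> has no root; on a line it has degree \<open>2k > 4\<close>. So there are at most \<open>2k\<close>
  common neighbours. Conversely, for each of about \<open>q^9\<close> pairs of dual circles a positive proportion
  of the polynomials \<open>g\<close> produces exactly \<open>2k\<close> solutions, by interpolation at \<open>2k - 1\<close> points and
  Vieta's formula for the last one, and averaging over \<open>g\<close> gives \<open>c q^9\<close> copies of \<open>K\<^sub>2\<^sub>k\<^sub>,\<^sub>2\<^sub>k\<close> on
  at most \<open>4 q^3\<close> vertices.
\<close>

section \<open>Copies of complete bipartite graphs\<close>

text \<open>An isomorphism carries separate maps on vertices and arcs. As tail and head of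
  \<open>with_proj\<close> are the projections, the arc map applies the vertex map to both ends, so
  the image is again complete bipartite.\<close>

lemma copy_of_complete_bipartite:
  fixes S :: "'a pair_pre_digraph"
  assumes "digraph_iso (with_proj (complete_bipartite s t)) (with_proj S)"
  obtains U V where "pverts S = U \<union> V" "parcs S = U \<times> V \<union> V \<times> U" "U \<inter> V = {}"
    "card U = s" "card V = t" "finite U" "finite V"
proof -
  let ?B = "complete_bipartite s t"
  obtain f where f: "pre_digraph.digraph_isomorphism (with_proj ?B) f" "with_proj S = app_iso f (with_proj ?B)"
    using assms unfolding digraph_iso_def by blast
  define U where "U = iso_verts f ` {0..<s}"
  define V where "V = iso_verts f ` {s..<s+t}"
  have inj: "inj_on (iso_verts f) {0..<s+t}"
    using pre_digraph.digraph_isomorphism_inj_on_verts[OF f(1)] by (simp add: complete_bipartite_def)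
  have verts: "pverts S = iso_verts f ` {0..<s+t}"
    using arg_cong[OF f(2), of verts] by (simp add: complete_bipartite_def)
  have tl: "fst = iso_tail f" "snd = iso_head f"
    using arg_cong[OF f(2), of tail] arg_cong[OF f(2), of head] by simp_all
  have arcs: "parcs S = iso_arcs f ` parcs ?B"
    using arg_cong[OF f(2), of arcs] by simp
  have "iso_arcs f e = (iso_verts f (fst e), iso_verts f (snd e))" if "e \<in> parcs ?B" for e
    using f(1) that unfolding pre_digraph.digraph_isomorphism_def by (simp flip: tl add: prod_eq_iff)
  then have "parcs S = (\<lambda>(x, y). (iso_verts f x, iso_verts f y)) ` parcs ?B"
    unfolding arcs by (intro image_cong) auto
  also have "\<dots> = U \<times> V \<union> V \<times> U"
    by (simp only: complete_bipartite_def pair_pre_digraph.simps image_Un image_paired_Times U_def V_def)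
  finally have 1: "parcs S = U \<times> V \<union> V \<times> U" .
  have 2: "pverts S = U \<union> V"
    unfolding verts U_def V_def by (subst image_Un[symmetric]) (rule arg_cong[of _ _ "\<lambda>A. iso_verts f ` A"], auto)
  have 3: "U \<inter> V = {}"
    unfolding U_def V_def by (subst inj_on_image_Int[OF inj, symmetric]) auto
  have 4: "card U = s" "card V = t"
    unfolding U_def V_def by (subst card_image; force intro: inj_on_subset[OF inj])+
  show ?thesis using that 1 2 3 4 by (simp add: U_def V_def)
qed

lemma copy_of_complete_bipartiteI:
  fixes S :: "'a pair_pre_digraph"
  assumes "pverts S = U \<union> V" "parcs S = U \<times> V \<union> V \<times> U" "U \<inter> V = {}"
    "card U = s" "card V = t" "finite U" "finite V"
  shows "digraph_iso (with_proj (complete_bipartite s t)) (with_proj S)"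
proof -
  let ?B = "complete_bipartite s t"
  obtain g where g: "bij_betw g {0..<s} U"
    using ex_bij_betw_nat_finite[OF assms(6)] assms(4) by auto
  obtain h where h: "bij_betw h {s..<s+t} V"
    using finite_same_card_bij[of "{s..<s+t}" V] assms by auto
  define v where "v i = (if i < s then g i else h i)" for i
  have vU: "v ` {0..<s} = U" using g by (auto simp: v_def bij_betw_def)
  have vV: "v ` {s..<s+t} = V" using h by (auto simp: v_def bij_betw_def)
  have split: "{0..<s+t} = {0..<s} \<union> {s..<s+t}" by auto
  have inj: "inj_on v {0..<s+t}"
  proof -
    have "inj_on v {0..<s}" "inj_on v {s..<s+t}"
      using inj_on_cong[of "{0..<s}" v g] inj_on_cong[of "{s..<s+t}" v h] g h
      by (simp_all add: v_def bij_betw_def)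
    moreover have "v ` ({0..<s} - {s..<s+t}) \<inter> v ` ({s..<s+t} - {0..<s}) = {}"
      using vU vV assms(3) by blast
    ultimately show ?thesis unfolding split inj_on_Un by blast
  qed
  define f :: "(nat, nat \<times> nat, 'a, 'a \<times> 'a) digraph_isomorphism" where
    "f = \<lparr>iso_verts = v, iso_arcs = (\<lambda>(x,y). (v x, v y)), iso_head = snd, iso_tail = fst\<rparr>"
  have wf: "wf_digraph (with_proj ?B)"
    unfolding wf_digraph_wp_iff by unfold_locales (auto simp: complete_bipartite_def)
  have "pre_digraph.digraph_isomorphism (with_proj ?B) f"
    unfolding pre_digraph.digraph_isomorphism_def
  proof (intro conjI ballI)
    have "inj_on (map_prod v v) (parcs ?B)"
      by (rule inj_on_subset[OF map_prod_inj_on[OF inj inj]]) (auto simp: complete_bipartite_def)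
    then show "inj_on (iso_arcs f) (arcs (with_proj ?B))"
      by (simp add: f_def map_prod_def)
    show "inj_on (iso_verts f) (verts (with_proj ?B))"
      using inj by (simp add: f_def complete_bipartite_def)
  qed (use wf in \<open>simp_all add: f_def split_beta\<close>)
  moreover have "with_proj S = app_iso f (with_proj ?B)"
  proof -
    have "(\<lambda>(x,y). (v x, v y)) ` parcs ?B = U \<times> V \<union> V \<times> U"
      by (simp only: complete_bipartite_def pair_pre_digraph.simps image_Un image_paired_Times vU vV)
    moreover have "v ` pverts ?B = U \<union> V"
      unfolding vU[symmetric] vV[symmetric] image_Un[symmetric] by (simp add: complete_bipartite_def ivl_disj_un)
    ultimately show ?thesis
      using assms(1,2) by (simp add: app_iso_def with_proj_def f_def)
  qed
  ultimately show ?thesis unfolding digraph_iso_def by blast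
qed

lemma subgraph_with_proj_iff:
  fixes S G :: "'a pair_pre_digraph"
  shows "subgraph (with_proj S) (with_proj G) \<longleftrightarrow>
    pair_wf_digraph S \<and> pair_wf_digraph G \<and> pverts S \<subseteq> pverts G \<and> parcs S \<subseteq> parcs G"
  by (auto simp: subgraph_def compatible_def wf_digraph_wp_iff)

lemma pair_wf_complete_bipartite:
  assumes "pverts S = U \<union> V" "parcs S = U \<times> V \<union> V \<times> U"
  shows "pair_wf_digraph S"
proof
  fix e assume "e \<in> parcs S"
  then have "fst e \<in> U \<union> V \<and> snd e \<in> U \<union> V" unfolding assms(2) by (elim UnE SigmaE) simp_all
  then show "fst e \<in> pverts S" "snd e \<in> pverts S" unfolding assms(1) by blast+
qed

text \<open>From here on copies are handled as pairs of vertex classes. Only arcs from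
  \<open>U\<close> to \<open>V\<close> are listed, since the symmetry of \<open>G\<close> supplies
  the reverse ones.\<close>

lemma in_copies_complete_bipartite_iff:
  fixes G S :: "'a pair_pre_digraph"
  assumes "pair_graph G"
  shows "S \<in> copies (complete_bipartite s t) G \<longleftrightarrow>
    (\<exists>U V. S = \<lparr>pverts = U \<union> V, parcs = U \<times> V \<union> V \<times> U\<rparr> \<and> U \<inter> V = {} \<and> finite U \<and> finite V \<and>
       card U = s \<and> card V = t \<and> U \<union> V \<subseteq> pverts G \<and> U \<times> V \<subseteq> parcs G)"
    (is "_ \<longleftrightarrow> ?R")
proof
  interpret pair_graph G by fact
  assume "S \<in> copies (complete_bipartite s t) G"
  then have sub: "pverts S \<subseteq> pverts G" "parcs S \<subseteq> parcs G"
    and iso: "digraph_iso (with_proj (complete_bipartite s t)) (with_proj S)"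
    unfolding copies_def subgraph_with_proj_iff by auto
  from iso obtain U V where "pverts S = U \<union> V" "parcs S = U \<times> V \<union> V \<times> U" "U \<inter> V = {}"
    "card U = s" "card V = t" "finite U" "finite V"
    by (rule copy_of_complete_bipartite)
  with sub show ?R by (intro exI[of _ U] exI[of _ V]) auto
next
  interpret pair_graph G by fact
  assume ?R
  then obtain U V where S: "S = \<lparr>pverts = U \<union> V, parcs = U \<times> V \<union> V \<times> U\<rparr>" "U \<inter> V = {}" "finite U" "finite V"
    "card U = s" "card V = t" "U \<union> V \<subseteq> pverts G" "U \<times> V \<subseteq> parcs G" by blast
  have "V \<times> U \<subseteq> parcs G"
    using S(8) pair_sym_arcs by (force simp: symmetric_def dest: symD)
  then show "S \<in> copies (complete_bipartite s t) G"
    unfolding copies_def subgraph_with_proj_iff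
    using S pair_wf_digraph copy_of_complete_bipartiteI[of S U V s t] pair_wf_complete_bipartite[of S U V]
    by simp
qed

lemma free_of_iff_copies: "free_of H G \<longleftrightarrow> copies H G = {}"
  unfolding free_of_def copies_def by blast

text \<open>Any \<open>s\<close> points of \<open>P\<close> together with \<open>t\<close> common
  neighbours would span a forbidden copy; their disjointness comes from the absence of
  loops.\<close>

lemma card_common_nbrs_less:
  fixes G :: "'a pair_pre_digraph"
  assumes G: "pair_graph G" "free_of (complete_bipartite s t) G"
    and P: "finite P" "card P \<ge> s" "P \<subseteq> pverts G" "s > 0"
  shows "card {y \<in> pverts G. \<forall>x\<in>P. (x, y) \<in> parcs G} < t"
proof (rule ccontr)
  interpret pair_graph G by fact
  let ?W = "{y \<in> pverts G. \<forall>x\<in>P. (x, y) \<in> parcs G}"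
  assume "\<not> card ?W < t"
  then have "t \<le> card ?W" by simp
  then obtain V where V: "V \<subseteq> ?W" "card V = t" "finite V"
    by (rule obtain_subset_with_card_n)
  obtain U where U: "U \<subseteq> P" "card U = s" "finite U"
    using P(2) by (rule obtain_subset_with_card_n)
  have "U \<inter> V = {}"
    using U V pair_no_loops by fastforce
  then have "\<lparr>pverts = U \<union> V, parcs = U \<times> V \<union> V \<times> U\<rparr> \<in> copies (complete_bipartite s t) G"
    unfolding in_copies_complete_bipartite_iff[OF G(1)] using U V P(3)
    by (intro exI[of _ U] exI[of _ V]) auto
  then show False using G(2) unfolding free_of_iff_copies by blast
qed

lemma gen_turan_le:
  assumes "parcs H \<noteq> {}"
    and "\<And>G :: nat pair_pre_digraph. pair_graph G \<Longrightarrow> card (pverts G) = n \<Longrightarrow> free_of H G \<Longrightarrow>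
           card (copies F G) \<le> m"
  shows "gen_turan n F H \<le> m"
  unfolding gen_turan_def using copy_counts_nonempty[OF assms(1), of n F] copy_counts_finite[of n F H] assms(2)
  by (subst Max_le_iff) (auto simp: copy_counts_def)

lemma gen_turan_ge:
  fixes G :: "nat pair_pre_digraph"
  assumes "pair_graph G" "card (pverts G) = n" "free_of H G"
  shows "card (copies F G) \<le> gen_turan n F H"
  unfolding gen_turan_def using copy_counts_finite[of n F H] assms
  by (intro Max_ge) (auto simp: copy_counts_def)

lemma parcs_complete_bipartite_nonempty: "s > 0 \<Longrightarrow> t > 0 \<Longrightarrow> parcs (complete_bipartite s t) \<noteq> {}"
  by (auto simp: complete_bipartite_def)


section \<open>The upper bound\<close>

lemma card_copies_complete_bipartite_le:
  fixes G :: "'a pair_pre_digraph"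
  assumes G: "pair_graph G" "free_of (complete_bipartite 3 t) G" and ab: "3 \<le> a" "3 \<le> b"
  shows "card (copies (complete_bipartite a b) G) \<le> 4 ^ t * card (pverts G) ^ 3"
proof -
  interpret pair_graph G by fact
  define W where "W P = {y \<in> pverts G. \<forall>x\<in>P. (x, y) \<in> parcs G}" for P
  have finW: "finite (W P)" for P unfolding W_def by simp
  have W: "card (Pow (W P)) \<le> 2 ^ t" if "finite P" "card P \<ge> 3" "P \<subseteq> pverts G" for P
  proof -
    have "card (W P) < t"
      unfolding W_def using card_common_nbrs_less[OF G that] by simp
    then show ?thesis using finW by (simp add: card_Pow)
  qed
  define T where "T = {P. P \<subseteq> pverts G \<and> card P = 3}"
  have cT: "card T \<le> card (pverts G) ^ 3"
  proof -
    have "T \<subseteq> set ` {xs. set xs \<subseteq> pverts G \<and> length xs = 3}"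
      unfolding T_def by (auto simp: image_iff) (metis finite_distinct_list card_ge_0_finite distinct_card zero_less_numeral)
    then have "card T \<le> card {xs. set xs \<subseteq> pverts G \<and> length xs = 3}"
      by (rule surj_card_le[rotated]) (simp add: finite_lists_length_eq)
    then show ?thesis by (simp add: card_lists_length_eq)
  qed
  \<comment> \<open>A copy is encoded by a triple \<open>P\<close> inside \<open>U\<close>, followed
    by \<open>V\<close> and \<open>U\<close>. The triples number at most the cube of the order of
    \<open>G\<close>, while \<open>V\<close> and \<open>U\<close> are subsets of common
    neighbourhoods with fewer than \<open>t\<close> points, which gives two factors
    \<open>2 ^ t\<close>.\<close>
  define D where "D = (SIGMA P:T. SIGMA V:{V \<in> Pow (W P). card V \<ge> 3}. Pow (W V))"
  have finT: "finite T" unfolding T_def by simp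
  have finD: "finite D" unfolding D_def using finT finW by (intro finite_SigmaI) auto
  have "card D = (\<Sum>P\<in>T. \<Sum>V\<in>{V \<in> Pow (W P). card V \<ge> 3}. card (Pow (W V)))"
    unfolding D_def using finT finW by (subst card_SigmaI) (auto intro!: finite_SigmaI sum.cong)
  also have "\<dots> \<le> (\<Sum>P\<in>T. 2 ^ t * 2 ^ t)"
  proof (rule sum_mono)
    fix P assume P: "P \<in> T"
    have "(\<Sum>V\<in>{V \<in> Pow (W P). card V \<ge> 3}. card (Pow (W V))) \<le> (\<Sum>V\<in>{V \<in> Pow (W P). card V \<ge> 3}. 2 ^ t)"
      by (intro sum_mono W) (use finW in \<open>auto simp: W_def intro: finite_subset\<close>)
    also have "\<dots> \<le> 2 ^ t * 2 ^ t"
    proof -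
      have "card {V \<in> Pow (W P). card V \<ge> 3} \<le> card (Pow (W P))"
        by (intro card_mono) (use finW in auto)
      also have "\<dots> \<le> 2 ^ t"
        using P by (intro W) (auto simp: T_def card_ge_0_finite)
      finally show ?thesis by simp
    qed
    finally show "(\<Sum>V\<in>{V \<in> Pow (W P). card V \<ge> 3}. card (Pow (W V))) \<le> 2 ^ t * 2 ^ t" .
  qed
  also have "\<dots> = 4 ^ t * card T" by (simp add: power_mult_distrib[symmetric])
  also have "\<dots> \<le> 4 ^ t * card (pverts G) ^ 3" using cT by simp
  finally have cD: "card D \<le> 4 ^ t * card (pverts G) ^ 3" .
  have "copies (complete_bipartite a b) G \<subseteq>
      (\<lambda>(P, V, U). \<lparr>pverts = U \<union> V, parcs = U \<times> V \<union> V \<times> U\<rparr>) ` D"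
  proof
    fix S assume "S \<in> copies (complete_bipartite a b) G"
    then obtain U V where S: "S = \<lparr>pverts = U \<union> V, parcs = U \<times> V \<union> V \<times> U\<rparr>" "U \<inter> V = {}"
        "finite U" "finite V" "card U = a" "card V = b" "U \<union> V \<subseteq> pverts G" "U \<times> V \<subseteq> parcs G"
      unfolding in_copies_complete_bipartite_iff[OF G(1)] by blast
    obtain P where P: "P \<subseteq> U" "card P = 3"
      using obtain_subset_with_card_n[of 3 U] S ab by metis
    have "V \<times> U \<subseteq> parcs G"
      using S(8) pair_sym_arcs by (force simp: symmetric_def dest: symD)
    then have "(P, V, U) \<in> D"
      unfolding D_def T_def W_def using S P ab by auto
    then show "S \<in> (\<lambda>(P, V, U). \<lparr>pverts = U \<union> V, parcs = U \<times> V \<union> V \<times> U\<rparr>) ` D"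
      using S(1) by force
  qed
  then have "card (copies (complete_bipartite a b) G) \<le> card D"
    using finD by (rule surj_card_le[rotated])
  with cD show ?thesis by linarith
qed


section \<open>Lower bounds from a bipartite incidence relation\<close>

lemma gen_turan_ge_incidence:
  fixes A :: "'x set" and B :: "'y set" and R :: "'x \<Rightarrow> 'y \<Rightarrow> bool"
  assumes fin: "finite A" "finite B" and n: "card A + card B \<le> n" and t: "t > 0"
    and A3: "\<And>P. P \<subseteq> A \<Longrightarrow> card P = 3 \<Longrightarrow> card {y \<in> B. \<forall>x\<in>P. R x y} < t"
    and B3: "\<And>Q. Q \<subseteq> B \<Longrightarrow> card Q = 3 \<Longrightarrow> card {x \<in> A. \<forall>y\<in>Q. R x y} < t"
    and PQ: "\<And>P Q. (P, Q) \<in> PQs \<Longrightarrow>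
      P \<subseteq> A \<and> Q \<subseteq> B \<and> card P = a \<and> card Q = b \<and> (\<forall>x\<in>P. \<forall>y\<in>Q. R x y)"
  shows "card PQs \<le> gen_turan n (complete_bipartite a b) (complete_bipartite 3 t)"
proof -
  define V where "V = Inl ` A \<union> Inr ` B"
  have finV: "finite V" unfolding V_def using fin by simp
  have "card V \<le> n"
    using n fin unfolding V_def by (subst card_Un_disjoint) (auto simp: card_image)
  then have "card V \<le> card {0..<n}" by simp
  then obtain \<phi> where \<phi>: "\<phi> ` V \<subseteq> {0..<n}" "inj_on \<phi> V"
    using card_le_inj[OF finV] by (metis finite_atLeastLessThan)
  define u where "u = \<phi> \<circ> Inl"
  define v where "v = \<phi> \<circ> Inr"
  have inj: "inj_on u A" "inj_on v B"
    using \<phi>(2) by (auto simp: u_def v_def V_def inj_on_def)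
  have disj: "u x \<noteq> v y" if "x \<in> A" "y \<in> B" for x y
    using \<phi>(2) that by (auto simp: u_def v_def V_def inj_on_def)
  have less: "x \<in> A \<Longrightarrow> u x < n" "y \<in> B \<Longrightarrow> v y < n" for x y
    using \<phi>(1) unfolding u_def v_def V_def by (fastforce simp: image_subset_iff)+
  define E where "E = {(u x, v y) | x y. x \<in> A \<and> y \<in> B \<and> R x y}"
  \<comment> \<open>Numbers outside the images of \<open>A\<close> and \<open>B\<close> become
    isolated vertices that pad the graph to order \<open>n\<close>.\<close>
  define G where "G = \<lparr>pverts = {0..<n}, parcs = E \<union> E\<inverse>\<rparr>"
  have E_iff: "(u x, v y) \<in> parcs G \<longleftrightarrow> R x y" "(v y, u x) \<in> parcs G \<longleftrightarrow> R x y" if "x \<in> A" "y \<in> B" for x y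
    using that inj_onD[OF inj(1)] inj_onD[OF inj(2)] disj unfolding G_def E_def by (auto; metis)+
  have finE: "finite E"
    by (rule finite_subset[of _ "u ` A \<times> v ` B"]) (use fin in \<open>auto simp: E_def\<close>)
  have G: "pair_graph G"
    by unfold_locales (use finE less disj disj[symmetric] in \<open>auto simp: G_def E_def symmetric_def sym_def\<close>)
  have "copies (complete_bipartite 3 t) G = {}"
  proof (rule ccontr)
    assume "copies (complete_bipartite 3 t) G \<noteq> {}"
    then obtain P Q where PQ: "finite P" "finite Q" "card P = 3" "card Q = t" "P \<times> Q \<subseteq> parcs G"
      unfolding ex_in_conv[symmetric] in_copies_complete_bipartite_iff[OF G] by blast
    obtain p where p: "p \<in> P" using PQ(3) by fastforce
    obtain r where r: "r \<in> Q" using PQ(4) t by fastforce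
    have ends: "x \<in> u ` A \<and> y \<in> v ` B \<or> x \<in> v ` B \<and> y \<in> u ` A" if "(x, y) \<in> parcs G" for x y
      using that by (auto simp: G_def E_def)
    have uv: "u ` A \<inter> v ` B = {}" using disj by auto
    \<comment> \<open>The point \<open>p\<close> lies in one class and forces all of
      \<open>Q\<close> into the other; the point \<open>r\<close> of \<open>Q\<close> then forces
      \<open>P\<close> into the class of \<open>p\<close>. The part of size 3 may thus lie on either
      side, which is why both \<open>A3\<close> and \<open>B3\<close> are assumed.\<close>
    consider "P \<subseteq> u ` A" "Q \<subseteq> v ` B" | "P \<subseteq> v ` B" "Q \<subseteq> u ` A"
      using p r PQ(5) ends uv by (smt (verit) disjoint_iff mem_Sigma_iff subset_iff)
    then show False
    proof cases
      case 1
      obtain P' where P': "P' \<subseteq> A" "P = u ` P'" using 1(1) by (auto simp: subset_image_iff)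
      obtain Q' where Q': "Q' \<subseteq> B" "Q = v ` Q'" using 1(2) by (auto simp: subset_image_iff)
      have c: "card P' = 3" "card Q' = t"
        using P' Q' PQ(3,4) inj by (metis card_image inj_on_subset)+
      have "Q' \<subseteq> {y \<in> B. \<forall>x\<in>P'. R x y}"
        using PQ(5) P' Q' E_iff by (blast intro: imageI SigmaI)
      then have "t \<le> card {y \<in> B. \<forall>x\<in>P'. R x y}"
        using c fin by (metis (no_types, lifting) card_mono finite_subset mem_Collect_eq subsetI)
      with A3[OF P'(1) c(1)] show False by simp
    next
      case 2
      obtain P' where P': "P' \<subseteq> B" "P = v ` P'" using 2(1) by (auto simp: subset_image_iff)
      obtain Q' where Q': "Q' \<subseteq> A" "Q = u ` Q'" using 2(2) by (auto simp: subset_image_iff)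
      have c: "card P' = 3" "card Q' = t"
        using P' Q' PQ(3,4) inj by (metis card_image inj_on_subset)+
      have "Q' \<subseteq> {x \<in> A. \<forall>y\<in>P'. R x y}"
        using PQ(5) P' Q' E_iff by (blast intro: imageI SigmaI)
      then have "t \<le> card {x \<in> A. \<forall>y\<in>P'. R x y}"
        using c fin by (metis (no_types, lifting) card_mono finite_subset mem_Collect_eq subsetI)
      with B3[OF P'(1) c(1)] show False by simp
    qed
  qed
  then have free: "free_of (complete_bipartite 3 t) G" unfolding free_of_iff_copies .
  define copy where "copy = (\<lambda>(P, Q). \<lparr>pverts = u ` P \<union> v ` Q, parcs = u ` P \<times> v ` Q \<union> v ` Q \<times> u ` P\<rparr>)"
  have "inj_on copy PQs"
  proof (rule inj_onI, clarify)
    fix P Q P' Q' assume *: "(P, Q) \<in> PQs" "(P', Q') \<in> PQs" "copy (P, Q) = copy (P', Q')"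
    note s = PQ[OF *(1)] PQ[OF *(2)]
    have eq: "u ` P \<union> v ` Q = u ` P' \<union> v ` Q'" using *(3) by (simp add: copy_def)
    have d: "u ` S \<inter> v ` T = {}" if "S \<subseteq> A" "T \<subseteq> B" for S T using that disj by blast
    have "u ` P = u ` P'" "v ` Q = v ` Q'"
    proof -
      have "u ` P = (u ` P \<union> v ` Q) \<inter> u ` A" "u ` P' = (u ` P' \<union> v ` Q') \<inter> u ` A"
        using d[of A Q] d[of A Q'] s by blast+
      then show "u ` P = u ` P'" unfolding eq by simp
      have "v ` Q = (u ` P \<union> v ` Q) \<inter> v ` B" "v ` Q' = (u ` P' \<union> v ` Q') \<inter> v ` B"
        using d[of P B] d[of P' B] s by blast+
      then show "v ` Q = v ` Q'" unfolding eq by simp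
    qed
    then show "P = P' \<and> Q = Q'"
      using inj s by (metis inj_on_image_eq_iff)
  qed
  moreover have "copy ` PQs \<subseteq> copies (complete_bipartite a b) G"
  proof (rule image_subsetI, clarify)
    fix P Q assume "(P, Q) \<in> PQs"
    note s = PQ[OF this]
    have f: "finite P" "finite Q" using s fin by (auto intro: finite_subset)
    show "copy (P, Q) \<in> copies (complete_bipartite a b) G"
      unfolding in_copies_complete_bipartite_iff[OF G] copy_def
    proof (rule exI[of _ "u ` P"], rule exI[of _ "v ` Q"], intro conjI)
      show "card (u ` P) = a" "card (v ` Q) = b"
        using s inj by (metis card_image inj_on_subset)+
      show "u ` P \<union> v ` Q \<subseteq> pverts G" using s less by (auto simp: G_def)
      show "u ` P \<times> v ` Q \<subseteq> parcs G"
      proof clarify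
        fix x y assume "x \<in> P" "y \<in> Q"
        then show "(u x, v y) \<in> parcs G" using s E_iff(1)[of x y] by blast
      qed
      show "u ` P \<inter> v ` Q = {}" using s disj by blast
    qed (use f in auto)
  qed
  ultimately have "card PQs \<le> card (copies (complete_bipartite a b) G)"
    using copies_card_le(1)[OF G] by (metis card_inj_on_le)
  also have "\<dots> \<le> gen_turan n (complete_bipartite a b) (complete_bipartite 3 t)"
    by (rule gen_turan_ge[OF G _ free]) (simp add: G_def)
  finally show ?thesis .
qed

section \<open>Linear factors of polynomials and Vieta's formula\<close>

lemma root_list_dvd:
  fixes p :: "'a::idom poly"
  assumes "distinct xs" "\<And>x. x \<in> set xs \<Longrightarrow> poly p x = 0"
  shows "(\<Prod>x\<leftarrow>xs. [:-x, 1:]) dvd p"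
  using assms
proof (induction xs arbitrary: p)
  case (Cons x xs)
  then have "[:-x, 1:] dvd p" by (simp add: poly_eq_0_iff_dvd)
  then obtain r where r: "p = [:-x, 1:] * r" by (rule dvdE)
  have "poly r y = 0" if "y \<in> set xs" for y
    using Cons.prems(2)[of y] Cons.prems(1) that unfolding r by auto
  with Cons.IH[of r] Cons.prems(1) have "(\<Prod>x\<leftarrow>xs. [:-x, 1:]) dvd r" by simp
  then show ?case unfolding r by (simp add: mult_dvd_mono del: mult_pCons_left)
qed simp

lemma degree_prod_list_linear: "degree (\<Prod>x\<leftarrow>xs. [:-x, 1::'a::idom:]) = length xs"
  and lead_coeff_prod_list_linear: "lead_coeff (\<Prod>x\<leftarrow>xs. [:-x, 1::'a::idom:]) = 1"
proof -
  have "degree (\<Prod>x\<leftarrow>xs. [:-x, 1::'a:]) = length xs \<and> coeff (\<Prod>x\<leftarrow>xs. [:-x, 1::'a:]) (length xs) = 1"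
  proof (induction xs)
    case (Cons x xs)
    then have "(\<Prod>x\<leftarrow>xs. [:-x, 1::'a:]) \<noteq> 0" by force
    with Cons have "degree ([:-x, 1:] * (\<Prod>x\<leftarrow>xs. [:-x, 1::'a:])) = Suc (length xs)"
      by (subst degree_mult_eq) auto
    moreover have "coeff ([:-x, 1:] * (\<Prod>x\<leftarrow>xs. [:-x, 1::'a:])) (Suc (length xs)) = 1"
      using Cons.IH by (simp add: coeff_eq_0)
    ultimately show ?case by (simp del: mult_pCons_left)
  qed simp
  then show "degree (\<Prod>x\<leftarrow>xs. [:-x, 1::'a:]) = length xs" "lead_coeff (\<Prod>x\<leftarrow>xs. [:-x, 1::'a:]) = 1"
    by simp_all
qed


text \<open>All roots but one are known, and Vieta's formula gives the remaining one from the
  product of all roots, which is \<open>poly p 0 / lead_coeff p\<close> because the degree is even.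
  The root so found may already occur in \<open>xs\<close>.\<close>

lemma last_root:
  fixes p :: "'a::field poly"
  assumes "distinct xs" "\<And>x. x \<in> set xs \<Longrightarrow> poly p x = 0" "degree p = Suc (length xs)"
    "0 \<notin> set xs" "odd (length xs)"
  shows "poly p (poly p 0 / (lead_coeff p * prod_list xs)) = 0"
proof -
  let ?m = "\<Prod>x\<leftarrow>xs. [:-x, 1:]"
  obtain r where r: "p = ?m * r" using root_list_dvd[OF assms(1,2)] by (rule dvdE)
  have p0: "p \<noteq> 0" using assms(3) by auto
  then have "degree p = length xs + degree r"
    unfolding r by (subst degree_mult_eq) (auto simp: degree_prod_list_linear)
  then have "degree r = 1" using assms(3) by simp
  then obtain a b where ab: "r = [:b, a:]" "a \<noteq> 0"
    by (cases r rule: pCons_cases) (auto split: if_splits elim!: degree_eq_zeroE)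
  have l: "lead_coeff p = a"
    unfolding r lead_coeff_mult lead_coeff_prod_list_linear using ab by simp
  have "poly ?m 0 = - prod_list xs"
    using \<open>odd (length xs)\<close>
  proof -
    have "poly ?m 0 = (-1) ^ length xs * prod_list xs" by (induction xs) auto
    with \<open>odd (length xs)\<close> show ?thesis by simp
  qed
  then have "poly p 0 = - prod_list xs * b" unfolding r using ab by simp
  moreover have "prod_list xs \<noteq> 0" using assms(4) by (simp add: prod_list_zero_iff)
  ultimately have "poly p 0 / (lead_coeff p * prod_list xs) = - b / a"
    unfolding l by (simp add: field_simps)
  then show ?thesis unfolding r using ab by simp
qed

section \<open>Norm, trace and circles in a quadratic extension\<close>

text \<open>The order \<open>q\<close> will grow with the number of vertices, so the field is a
  subset \<open>K\<close> of a fixed ambient field: the fixed points of the \<open>q * q\<close>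
  power map, with those of the \<open>q\<close> power map as subfield of order \<open>q\<close>. The
  last assumption counts norm fibres in the whole ambient field.\<close>

locale quadratic_field =
  fixes q :: nat and K :: "'a::field set"
  assumes q_ge: "q \<ge> 2"
    and K_eq: "K = {x. x ^ (q * q) = x}"
    and two_eq_0: "(2::'a) = 0"
    and frobenius_add: "(x + y :: 'a) ^ q = x ^ q + y ^ q"
    and card_K: "card K = q * q"
    and card_fixed: "card {x::'a. x ^ q = x} = q"
    and card_norm_fibre: "r \<noteq> 0 \<Longrightarrow> r ^ q = r \<Longrightarrow> card {x::'a. x * x ^ q = r} = q + 1"
begin

text \<open>On \<open>K\<close> this is the nontrivial automorphism over \<open>F\<close>, so that
  \<open>N\<close> and \<open>Tr\<close> are there the norm and trace of \<open>K\<close> over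
  \<open>F\<close>. The ambient points on which it is an involution are exactly those of
  \<open>K\<close>.\<close>

definition cj :: "'a \<Rightarrow> 'a" where "cj x = x ^ q"
definition F :: "'a set" where "F = {x. cj x = x}"
definition N :: "'a \<Rightarrow> 'a" where "N x = x * cj x"
definition Tr :: "'a \<Rightarrow> 'a" where "Tr x = x + cj x"

lemma cj_0 [simp]: "cj 0 = 0" using q_ge by (simp add: cj_def)
lemma cj_1 [simp]: "cj 1 = 1" by (simp add: cj_def)
lemma cj_add [simp]: "cj (x + y) = cj x + cj y" by (simp add: cj_def frobenius_add)
lemma cj_mult [simp]: "cj (x * y) = cj x * cj y" by (simp add: cj_def power_mult_distrib)
lemma cj_uminus [simp]: "cj (- x) = - cj x"
  using cj_add[of x "- x"] minus_unique[of "cj x" "cj (- x)"] by (simp del: cj_add)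
lemma cj_diff [simp]: "cj (x - y) = cj x - cj y" using cj_add[of x "- y"] by simp
lemma cj_divide [simp]: "cj (x / y) = cj x / cj y" by (simp add: cj_def power_divide)
lemma cj_power [simp]: "cj (x ^ n) = cj x ^ n" by (induction n) auto
lemma cj_eq_0_iff [simp]: "cj x = 0 \<longleftrightarrow> x = 0" using q_ge by (simp add: cj_def)
lemma cj_sum: "cj (sum f A) = (\<Sum>x\<in>A. cj (f x))" by (induction A rule: infinite_finite_induct) auto

lemma K_iff: "x \<in> K \<longleftrightarrow> cj (cj x) = x" by (simp add: K_eq cj_def power_mult)

lemma K_closed [simp, intro]:
  "0 \<in> K" "1 \<in> K" "x \<in> K \<Longrightarrow> y \<in> K \<Longrightarrow> x + y \<in> K" "x \<in> K \<Longrightarrow> y \<in> K \<Longrightarrow> x * y \<in> K"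
  "x \<in> K \<Longrightarrow> - x \<in> K" "x \<in> K \<Longrightarrow> y \<in> K \<Longrightarrow> x - y \<in> K" "x \<in> K \<Longrightarrow> y \<in> K \<Longrightarrow> x / y \<in> K"
  "x \<in> K \<Longrightarrow> x ^ n \<in> K" "x \<in> K \<Longrightarrow> cj x \<in> K"
  by (simp_all add: K_iff)

lemma cj_cj [simp]: "x \<in> K \<Longrightarrow> cj (cj x) = x" by (simp add: K_iff)

lemma F_iff: "x \<in> F \<longleftrightarrow> cj x = x" by (simp add: F_def)
lemma cj_F [simp]: "x \<in> F \<Longrightarrow> cj x = x" by (simp add: F_def)
lemma F_K [simp, intro]: "x \<in> F \<Longrightarrow> x \<in> K" unfolding F_def K_iff by auto

lemma F_closed [simp, intro]:
  "0 \<in> F" "1 \<in> F" "x \<in> F \<Longrightarrow> y \<in> F \<Longrightarrow> x + y \<in> F" "x \<in> F \<Longrightarrow> y \<in> F \<Longrightarrow> x * y \<in> F"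
  "x \<in> F \<Longrightarrow> - x \<in> F" "x \<in> F \<Longrightarrow> y \<in> F \<Longrightarrow> x - y \<in> F" "x \<in> F \<Longrightarrow> y \<in> F \<Longrightarrow> x / y \<in> F"
  "x \<in> K \<Longrightarrow> N x \<in> F" "x \<in> K \<Longrightarrow> Tr x \<in> F"
  by (simp_all add: F_iff N_def Tr_def mult.commute add.commute)

lemma N_simps [simp]: "N 0 = 0" "N (x * y) = N x * N y" "N (x / y) = N x / N y" "N x = 0 \<longleftrightarrow> x = 0"
  "N (- x) = N x" "N (x ^ n) = N x ^ n"
  by (simp_all add: N_def power_mult_distrib)

lemma N_1 [simp]: "N 1 = 1" by (simp add: N_def)

lemma N_F [simp]: "s \<in> F \<Longrightarrow> N s = s ^ 2" by (simp add: N_def power2_eq_square)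

lemma N_cj [simp]: "x \<in> K \<Longrightarrow> N (cj x) = N x" by (simp add: N_def mult.commute)

lemma finite_K [simp]: "finite K" using card_K q_ge by (intro card_ge_0_finite) simp
lemma finite_F [simp]: "finite F" by (rule finite_subset[of _ K]) auto
lemma card_F: "card F = q" using card_fixed by (simp add: F_def cj_def)

lemma double_eq_0 [simp]: "x + x = (0::'a)" by (simp flip: mult_2 add: two_eq_0)
lemma uminus_eq [simp]: "- x = (x::'a)" using double_eq_0[of x] by (simp only: add_eq_0_iff)

definition circle :: "'a \<Rightarrow> 'a set" where "circle r = {e \<in> K. N e = r}"

lemma finite_circle [simp]: "finite (circle r)" by (simp add: circle_def)

text \<open>Solutions of \<open>N e = r\<close> in the ambient field already lie in
  \<open>K\<close>: as \<open>r\<close> is fixed by \<open>cj\<close>, cancelling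
  \<open>cj e\<close> from \<open>cj (N e) = N e\<close> leaves
  \<open>cj (cj e) = e\<close>.\<close>

lemma card_circle:
  assumes "r \<in> F" "r \<noteq> 0"
  shows "card (circle r) = q + 1"
proof -
  have "e \<in> K" if "N e = r" for e
  proof -
    have "cj (N e) = N e" using that assms by simp
    then have "cj e * (cj (cj e) - e) = 0" by (simp add: N_def algebra_simps)
    moreover have "e \<noteq> 0" using that assms by auto
    ultimately show ?thesis by (simp add: K_iff)
  qed
  then have "circle r = {e. N e = r}" by (auto simp: circle_def)
  then show ?thesis using card_norm_fibre[of r] assms by (simp add: N_def cj_def F_def)
qed

lemma cj_circle: "e \<in> circle r \<Longrightarrow> r \<noteq> 0 \<Longrightarrow> cj e = r / e"
  by (auto simp: circle_def N_def field_simps)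

lemma circle_nonzero: "e \<in> circle r \<Longrightarrow> r \<noteq> 0 \<Longrightarrow> e \<noteq> 0"
  by (auto simp: circle_def)

lemma quadratic_three_roots:
  fixes a b c :: 'a
  assumes "card S \<ge> 3" "\<And>x. x \<in> S \<Longrightarrow> a * x ^ 2 + b * x + c = 0"
  shows "a = 0 \<and> b = 0 \<and> c = 0"
proof -
  have "[:c, b, a:] = 0"
  proof (rule ccontr)
    assume nz: "[:c, b, a:] \<noteq> 0"
    have "card S \<le> card {x. poly [:c, b, a:] x = 0}"
      using assms(2) by (intro card_mono poly_roots_finite nz) (auto simp: algebra_simps power2_eq_square)
    also have "\<dots> \<le> degree [:c, b, a:]" by (rule card_poly_roots_bound[OF nz])
    also have "\<dots> \<le> 2" by simp
    finally show False using assms(1) by simp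
  qed
  then show ?thesis by simp
qed

text \<open>Multiplying the linear relation by \<open>e\<close> turns it into a quadratic equation, as \<open>e * cj e = r\<close>.\<close>

lemma three_points_on_circle:
  assumes S: "card S \<ge> 3" "S \<subseteq> circle r" and lin: "\<And>e. e \<in> S \<Longrightarrow> a * e + b * cj e + d = 0"
  shows "a = 0 \<and> b = 0 \<and> d = 0"
proof -
  have r: "r \<noteq> 0"
  proof
    assume "r = 0"
    then have "S \<subseteq> {0}" using S(2) by (auto simp: circle_def)
    then have "card S \<le> 1" using card_mono[of "{0}" S] by simp
    then show False using S(1) by simp
  qed
  have "a * e ^ 2 + d * e + b * r = 0" if "e \<in> S" for e
  proof -
    have "N e = r" using that S(2) by (auto simp: circle_def)
    then have "a * e ^ 2 + d * e + b * r = (a * e + b * cj e + d) * e"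
      by (auto simp: N_def algebra_simps power2_eq_square)
    then show ?thesis using lin[OF that] by simp
  qed
  from quadratic_three_roots[OF S(1) this] r show ?thesis by simp
qed

end

lemma regroup_linear_combination:
  fixes a b :: "'a::comm_ring"
  shows "(x + y * p + z * s) * a - (x' + y' * p + z' * s) * b
    = (x * a - x' * b) + (y * a - y' * b) * p + (z * a - z' * b) * s"
  by (simp add: algebra_simps)

lemma card_eq_sum_fibres:
  assumes "finite A" "finite B" "f ` A \<subseteq> B"
  shows "card A = (\<Sum>b\<in>B. card {a \<in> A. f a = b})"
  using assms by (subst card_eq_sum, subst sum.group[symmetric, of A B f]) auto


text \<open>The fibre sizes add up to \<open>m * card B\<close>, their largest possible total, so
  none can fall short.\<close>

lemma fibre_card_eq:
  assumes fin: "finite A" "finite B" "f ` A \<subseteq> B" and le: "\<And>b. b \<in> B \<Longrightarrow> card {a \<in> A. f a = b} \<le> m"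
    and card: "card A = m * card B" and b: "b \<in> B"
  shows "card {a \<in> A. f a = b} = m"
proof (rule ccontr)
  assume "card {a \<in> A. f a = b} \<noteq> m"
  with le[OF b] have "card {a \<in> A. f a = b} < m" by simp
  then have "(\<Sum>b\<in>B. card {a \<in> A. f a = b}) < (\<Sum>b\<in>B. m)"
    using le b fin by (intro sum_strict_mono_ex1) auto
  then show False using card_eq_sum_fibres[OF fin] card by (simp add: mult.commute)
qed

section \<open>Polynomials restricted to circles and real lines\<close>

context quadratic_field
begin

definition cjp :: "'a poly \<Rightarrow> 'a poly" where "cjp p = map_poly cj p"

lemma coeff_cjp [simp]: "coeff (cjp p) i = cj (coeff p i)"
  by (simp add: cjp_def coeff_map_poly)

lemma degree_cjp [simp]: "degree (cjp p) = degree p"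
  unfolding cjp_def by (rule degree_map_poly) simp

lemma cj_poly: "cj (poly p x) = poly (cjp p) (cj x)"
  by (simp add: poly_altdef cj_sum)

text \<open>On the circle \<open>N e = r\<close> the conjugate of a polynomial of degree at most \<open>m\<close> becomes, after
  multiplication with \<open>e ^ m\<close>, again a polynomial in \<open>e\<close>.\<close>

definition rv :: "nat \<Rightarrow> 'a \<Rightarrow> 'a poly \<Rightarrow> 'a poly" where
  "rv m r p = (\<Sum>j\<le>m. monom (cj (coeff p j) * r ^ j) (m - j))"

lemma coeff_rv: "coeff (rv m r p) i = (if i \<le> m then cj (coeff p (m - i)) * r ^ (m - i) else 0)"
proof -
  have "coeff (rv m r p) i = (\<Sum>j\<le>m. if m - j = i then cj (coeff p j) * r ^ j else 0)"
    by (simp add: rv_def coeff_sum)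
  also have "\<dots> = (\<Sum>j\<le>m. if i \<le> m \<and> j = m - i then cj (coeff p j) * r ^ j else 0)"
    by (intro sum.cong) auto
  also have "\<dots> = (if i \<le> m then cj (coeff p (m - i)) * r ^ (m - i) else 0)"
    by auto
  finally show ?thesis .
qed

lemma degree_rv: "degree (rv m r p) \<le> m"
  by (rule degree_le) (simp add: coeff_rv)

lemma poly_rv:
  assumes e: "e \<in> circle r" "r \<noteq> 0" and p: "degree p \<le> m"
  shows "poly (rv m r p) e = e ^ m * cj (poly p e)"
proof -
  have e0: "e \<noteq> 0" using circle_nonzero e by blast
  have "poly p e = (\<Sum>j\<le>m. coeff p j * e ^ j)"
    unfolding poly_altdef using p by (intro sum.mono_neutral_left) (auto simp: coeff_eq_0)
  then have "cj (poly p e) = (\<Sum>j\<le>m. cj (coeff p j) * (r / e) ^ j)"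
    unfolding cj_circle[OF e, symmetric] by (simp add: cj_sum)
  then have "e ^ m * cj (poly p e) = (\<Sum>j\<le>m. cj (coeff p j) * r ^ j * (e ^ m / e ^ j))"
    by (simp add: sum_distrib_left power_divide mult_ac)
  also have "\<dots> = (\<Sum>j\<le>m. cj (coeff p j) * r ^ j * e ^ (m - j))"
    using e0 by (intro sum.cong) (auto simp: power_diff)
  also have "\<dots> = poly (rv m r p) e"
    by (simp add: rv_def poly_sum poly_monom)
  finally show ?thesis by simp
qed

lemma degree_pcompose_linear [simp]: "degree (pcompose p [:c, 1::'a:]) = degree p"
  by (simp add: degree_pcompose)

lemma poly_shift [simp]: "poly (pcompose p [:c, 1::'a:]) e = poly p (c + e)"
  by (simp add: poly_pcompose)

definition radius_poly :: "'a poly \<Rightarrow> 'a poly \<Rightarrow> 'a \<Rightarrow> 'a" where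
  "radius_poly h g x = N (poly h x) + Tr (poly g x)"

lemma radius_poly_F: "poly h x \<in> K \<Longrightarrow> poly g x \<in> K \<Longrightarrow> radius_poly h g x \<in> F"
  by (simp add: radius_poly_def)

text \<open>As \<open>k \<ge> 3\<close>, the norm of \<open>h\<close> alone contributes to the two extreme coefficients.\<close>

lemma circle_poly:
  assumes h: "degree h = k" "lead_coeff h = 1" "poly h c \<noteq> 0" and g: "degree g < k" and k: "k \<ge> 3"
    and r: "r \<noteq> 0" "r \<in> F" and K: "u \<in> K" "v \<in> K" "w \<in> K"
  obtains E where "degree E = 2 * k" "lead_coeff E = cj (poly h c)" "poly E 0 = poly h c * r ^ k"
    "\<And>e. e \<in> circle r \<Longrightarrow>
      poly E e = e ^ k * (radius_poly h g (c + e) - N (u + v * e + w * cj e))"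
proof -
  define H where "H = pcompose h [:c, 1:]"
  define G where "G = pcompose g [:c, 1:]"
  \<comment> \<open>\<open>A\<close>, \<open>B\<close> and \<open>C\<close> are \<open>e ^ k\<close>
    times the norm of \<open>h\<close>, the trace of \<open>g\<close> and the norm on the right-hand
    side, with \<open>cj e\<close> replaced by \<open>r / e\<close>. In \<open>C\<close> each of the
    two conjugate factors absorbs one \<open>e\<close>, which leaves
    \<open>e ^ (k - 2)\<close>.\<close>
  define A where "A = H * rv k r H"
  define B where "B = monom 1 k * G + monom 1 1 * rv (k - 1) r G"
  define C where "C = monom 1 (k - 2) * ([:w * r, u, v:] * [:cj v * r, cj u, cj w:])"
  define E where "E = A + B - C"
  have H: "degree H = k" "poly H 0 = poly h c" using h by (simp_all add: H_def)
  have "lead_coeff H = 1"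
    unfolding H_def using h by (subst lead_coeff_comp) simp_all
  then have H1: "coeff H k = 1" using H by simp
  have G: "degree G \<le> k - 1" using g by (simp add: G_def)
  have dA: "degree A \<le> 2 * k"
    using degree_mult_le[of H "rv k r H"] degree_rv[of k r H] H unfolding A_def by simp
  \<comment> \<open>The top coefficient of the reversed polynomial is the conjugate of the constant
    coefficient of \<open>H\<close>, which is \<open>poly h c\<close>.\<close>
  have cA: "coeff A (2 * k) = cj (poly h c)"
  proof -
    have "coeff A (degree H + k) = coeff H k * coeff (rv k r H) k"
    proof (cases "degree (rv k r H) = k")
      case True
      then show ?thesis unfolding A_def using H coeff_mult_degree_sum[of H "rv k r H"] by simp
    next
      case False
      then have "degree (rv k r H) < k" using degree_rv[of k r H] by simp
      then show ?thesis unfolding A_def using H degree_mult_le[of H "rv k r H"]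
        by (simp add: coeff_eq_0)
    qed
    then show ?thesis using H H1 by (simp add: coeff_rv mult_2 poly_0_coeff_0)
  qed
  have dB: "degree B < 2 * k"
  proof -
    have "degree (monom 1 k * G) \<le> k + (k - 1)"
      by (rule order_trans[OF degree_mult_le]) (use G in \<open>simp add: degree_monom_eq\<close>)
    moreover have "degree (monom 1 1 * rv (k - 1) r G) \<le> 1 + (k - 1)"
      by (rule order_trans[OF degree_mult_le])
        (use degree_rv[of "k - 1" r G] in \<open>simp add: degree_monom_eq\<close>)
    ultimately show ?thesis
      unfolding B_def using k by (intro degree_add_less) auto
  qed
  have dC: "degree C < 2 * k"
  proof -
    have "degree ([:w * r, u, v:] * [:cj v * r, cj u, cj w:]) \<le> 2 + 2"
      by (rule order_trans[OF degree_mult_le], rule add_mono) (auto simp: degree_pCons_eq_if)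
    then have "degree C \<le> (k - 2) + 4"
      unfolding C_def by (intro order_trans[OF degree_mult_le]) (simp add: degree_monom_eq)
    then show ?thesis using k by simp
  qed
  have "coeff E (2 * k) = cj (poly h c)"
    unfolding E_def using cA dB dC by (simp add: coeff_eq_0)
  moreover from this have "degree E \<ge> 2 * k" using h(3) by (intro le_degree) simp
  moreover have "degree E \<le> 2 * k"
    unfolding E_def using dA dB dC by (intro degree_diff_le degree_add_le) auto
  ultimately have E: "degree E = 2 * k" "lead_coeff E = cj (poly h c)" by auto
  have "poly C 0 = 0" "poly B 0 = 0"
    using k by (auto simp: C_def B_def poly_monom)
  moreover have "poly A 0 = poly h c * r ^ k"
    unfolding A_def using H H1 by (simp add: poly_0_coeff_0[of "rv k r H"] coeff_rv)
  ultimately have E0: "poly E 0 = poly h c * r ^ k" by (simp add: E_def)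
  have "poly E e = e ^ k * (radius_poly h g (c + e) - N (u + v * e + w * cj e))" if e: "e \<in> circle r" for e
  proof -
    have eK: "e \<in> K" and ee: "r = e * cj e" using e by (auto simp: circle_def N_def)
    have k1: "e ^ k = e * e ^ (k - 1)" "e ^ k = e ^ (k - 2) * e ^ 2"
    proof -
      have "1 + (k - 1) = k" "k - 2 + 2 = k" using k by simp_all
      then show "e ^ k = e * e ^ (k - 1)" "e ^ k = e ^ (k - 2) * e ^ 2"
        using power_add[of e 1 "k - 1"] power_add[of e "k - 2" 2] by (simp_all only: power_one_right)
    qed
    have "poly A e = e ^ k * N (poly h (c + e))"
      unfolding A_def using poly_rv[OF e r(1), of H k] H by (simp add: H_def N_def)
    moreover have "poly B e = e ^ k * Tr (poly g (c + e))"
      unfolding B_def using poly_rv[OF e r(1), of G "k - 1"] G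
      by (simp add: G_def Tr_def poly_monom k1(1) algebra_simps)
    moreover have "poly C e = e ^ k * N (u + v * e + w * cj e)"
      unfolding C_def k1(2) ee using eK K by (simp add: N_def poly_monom algebra_simps power2_eq_square)
    ultimately show ?thesis
      unfolding E_def radius_poly_def by (simp add: algebra_simps)
  qed
  with E E0 show ?thesis using that by blast
qed

lemma card_circle_zeros_le:
  assumes h: "degree h = k" "lead_coeff h = 1" "poly h c \<noteq> 0" and g: "degree g < k" and k: "k \<ge> 3"
    and r: "r \<noteq> 0" "r \<in> F" and K: "u \<in> K" "v \<in> K" "w \<in> K"
  shows "card {e \<in> circle r. radius_poly h g (c + e) = N (u + v * e + w * cj e)} \<le> 2 * k"
proof -
  obtain E where E: "degree E = 2 * k"
    "\<And>e. e \<in> circle r \<Longrightarrow> poly E e = e ^ k * (radius_poly h g (c + e) - N (u + v * e + w * cj e))"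
    using circle_poly[OF assms] by metis
  have E0: "E \<noteq> 0" using E(1) k by auto
  have "card {e \<in> circle r. radius_poly h g (c + e) = N (u + v * e + w * cj e)} \<le> card {e. poly E e = 0}"
    using E(2) by (intro card_mono poly_roots_finite E0) auto
  also have "\<dots> \<le> degree E" by (rule card_poly_roots_bound[OF E0])
  finally show ?thesis using E(1) by simp
qed

text \<open>Along a real line the norm of \<open>h\<close> has degree \<open>2 * k > 4\<close> and dominates the norm of any
  quadratic polynomial.\<close>

lemma card_line_zeros_le:
  assumes h: "degree h = k" "lead_coeff h = 1" and g: "degree g < k" and k: "k \<ge> 3" and a: "a \<noteq> 0"
  shows "card {s \<in> F. radius_poly h g (b + s * a) = N (d0 + d1 * s + d2 * s ^ 2)} \<le> 2 * k"
proof -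
  define H where "H = pcompose h [:b, a:]"
  define G where "G = pcompose g [:b, a:]"
  define D where "D = [:d0, d1, d2:]"
  \<comment> \<open>For \<open>s\<close> in \<open>F\<close> the conjugate of
    \<open>poly p s\<close> is \<open>poly (cjp p) s\<close>, which makes norm and trace polynomial
    in \<open>s\<close>.\<close>
  define E where "E = H * cjp H + (G + cjp G) - D * cjp D"
  have H: "degree H = k" using h a by (simp add: H_def degree_pcompose)
  moreover from this have "degree (cjp H) = k" by simp
  ultimately have "degree (cjp H) = k" "H \<noteq> 0" "cjp H \<noteq> 0" using k by force+
  then have HH: "degree (H * cjp H) = 2 * k" using H by (subst degree_mult_eq) auto
  have G: "degree (G + cjp G) < 2 * k"
    using g a k by (intro degree_add_less) (auto simp: G_def degree_pcompose)
  have "degree D \<le> 2" by (simp add: D_def degree_pCons_eq_if)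
  then have "degree (D * cjp D) \<le> 4"
    by (intro order_trans[OF degree_mult_le]) simp
  then have "degree (D * cjp D) < 2 * k" using k by simp
  with G have "degree ((G + cjp G) - D * cjp D) < degree (H * cjp H)"
    unfolding HH by (rule degree_diff_less)
  then have "degree (H * cjp H + ((G + cjp G) - D * cjp D)) = degree (H * cjp H)"
    by (rule degree_add_eq_left)
  then have E: "degree E = 2 * k" unfolding E_def HH by (simp add: algebra_simps)
  then have E0: "E \<noteq> 0" using k by auto
  have ev: "poly E s = radius_poly h g (b + s * a) - N (d0 + d1 * s + d2 * s ^ 2)" if "s \<in> F" for s
  proof -
    have 1: "poly (cjp p) s = cj (poly p s)" for p using cj_poly[of p s] that by simp
    show ?thesis
      by (simp add: E_def 1 radius_poly_def H_def G_def D_def poly_pcompose N_def Tr_def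
          algebra_simps power2_eq_square)
  qed
  have "card {s \<in> F. radius_poly h g (b + s * a) = N (d0 + d1 * s + d2 * s ^ 2)} \<le> card {e. poly E e = 0}"
    using ev by (intro card_mono poly_roots_finite E0) auto
  also have "\<dots> \<le> degree E" by (rule card_poly_roots_bound[OF E0])
  finally show ?thesis using E by simp
qed

section \<open>Common neighbours of three points\<close>

fun adj :: "'a \<times> 'a \<Rightarrow> 'a \<times> 'a \<Rightarrow> bool" where
  "adj (A, C) (B, D) \<longleftrightarrow> N (A + B) = Tr (C * D)"

lemma adj_commute: "adj x y \<longleftrightarrow> adj y x"
  by (cases x; cases y) (simp add: add.commute mult.commute)

definition surface :: "'a poly \<Rightarrow> 'a poly \<Rightarrow> ('a \<times> 'a) set" where
  "surface h g = {(A, C). A \<in> K \<and> C \<in> K \<and> N C = radius_poly h g A}"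

lemma finite_surface [simp]: "finite (surface h g)"
  by (rule finite_subset[of _ "K \<times> K"]) (auto simp: surface_def)

lemma N_add: "x \<in> K \<Longrightarrow> y \<in> K \<Longrightarrow> N (x + y) = N x + N y + Tr (cj x * y)"
  by (simp add: N_def Tr_def algebra_simps)

lemma Tr_add [simp]: "Tr (x + y) = Tr x + Tr y" by (simp add: Tr_def)

lemma Tr_F_mult [simp]: "s \<in> F \<Longrightarrow> Tr (s * x) = s * Tr x" by (simp add: Tr_def algebra_simps)


text \<open>The norm is a quadratic form over \<open>F\<close>, and the last term is its deviation
  from affinity along a line. This excludes the degenerate configurations in
  \<open>card_common_collinear\<close>.\<close>

lemma N_convex:
  assumes "t \<in> F" "x \<in> K" "y \<in> K"
  shows "N (t * x + (1 - t) * y) = t * N x + (1 - t) * N y - t * (1 - t) * N (x - y)"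
  using assms by (simp add: N_def algebra_simps del: uminus_eq)

text \<open>\<open>C * D\<close> and its conjugate have sum \<open>m\<close> and product
  \<open>N C * n\<close>, so \<open>C * D\<close> is a root of a fixed monic quadratic.\<close>

lemma card_trace_norm_le:
  assumes "C \<noteq> 0"
  shows "card {D \<in> K. Tr (C * D) = m \<and> N D = n} \<le> 2"
proof -
  let ?p = "[:N C * n, - m * C, C ^ 2:]"
  have nz: "?p \<noteq> 0" using assms by simp
  have "card {D \<in> K. Tr (C * D) = m \<and> N D = n} \<le> card {D. poly ?p D = 0}"
  proof (intro card_mono poly_roots_finite nz subsetI)
    fix D assume "D \<in> {D \<in> K. Tr (C * D) = m \<and> N D = n}"
    then have "m = C * D + cj C * cj D" "n = D * cj D" by (auto simp: Tr_def N_def)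
    then show "D \<in> {D. poly ?p D = 0}"
      by (simp add: N_def algebra_simps power2_eq_square del: uminus_eq)
  qed
  also have "\<dots> \<le> degree ?p" by (rule card_poly_roots_bound[OF nz])
  also have "\<dots> \<le> 2" by simp
  finally show ?thesis .
qed

definition common :: "'a poly \<Rightarrow> 'a poly \<Rightarrow> 'a \<times> 'a \<Rightarrow> 'a \<times> 'a \<Rightarrow> 'a \<times> 'a \<Rightarrow> ('a \<times> 'a) set" where
  "common h g x1 x2 x3 = {y \<in> surface h g. adj x1 y \<and> adj x2 y \<and> adj x3 y}"

context
  fixes h g :: "'a poly" and k :: nat
  assumes h: "degree h = k" "lead_coeff h = 1" and no_root: "\<And>x. x \<in> K \<Longrightarrow> poly h x \<noteq> 0"
    and g: "degree g < k" and k: "k \<ge> 3"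
begin

lemma commonD:
  assumes "(B, D) \<in> common h g (A1, C1) (A2, C2) (A3, C3)"
  shows "B \<in> K" "D \<in> K" "N D = radius_poly h g B"
    "N (A1 + B) = Tr (C1 * D)" "N (A2 + B) = Tr (C2 * D)" "N (A3 + B) = Tr (C3 * D)"
  using assms by (auto simp: common_def surface_def)


text \<open>Subtracting the third adjacency equation from the other two leaves two linear equations
  for \<open>D\<close> and \<open>cj D\<close> with nonzero determinant. So \<open>D\<close> is
  affine in \<open>B\<close> and \<open>cj B\<close>, and substitution into the third equation puts
  \<open>B\<close> on a circle.\<close>

lemma card_common_independent:
  assumes K: "A1 \<in> K" "A2 \<in> K" "A3 \<in> K" "C1 \<in> K" "C2 \<in> K" "C3 \<in> K"
    and indep: "(C1 - C3) * cj (C2 - C3) - cj (C1 - C3) * (C2 - C3) \<noteq> 0"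
  shows "card (common h g (A1, C1) (A2, C2) (A3, C3)) \<le> 2 * k"
proof -
  define d1 where "d1 = C1 - C3"
  define d2 where "d2 = C2 - C3"
  define \<Delta> where "\<Delta> = d1 * cj d2 - cj d1 * d2"
  define a1 where "a1 = A1 - A3"
  define a2 where "a2 = A2 - A3"
  \<comment> \<open>Cramer's rule gives \<open>D = U + V * B + W * cj B\<close>. In the third
    equation \<open>\<kappa>\<close> is then the coefficient of \<open>B\<close>, completing the
    norm gives the centre \<open>c\<close> and radius \<open>r\<close>, and \<open>u\<close> is the
    value of \<open>D\<close> at the centre.\<close>
  define U where "U = ((N A1 - N A3) * cj d2 - (N A2 - N A3) * cj d1) / \<Delta>"
  define V where "V = (cj a1 * cj d2 - cj a2 * cj d1) / \<Delta>"
  define W where "W = (a1 * cj d2 - a2 * cj d1) / \<Delta>"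
  define \<kappa> where "\<kappa> = cj A3 - C3 * V - cj C3 * cj W"
  define c where "c = - cj \<kappa>"
  define r where "r = N \<kappa> - (N A3 - Tr (C3 * U))"
  define u where "u = U + V * c + W * cj c"
  have \<Delta>: "\<Delta> \<noteq> 0" using indep by (simp add: \<Delta>_def d1_def d2_def)
  have dK: "d1 \<in> K" "d2 \<in> K" "a1 \<in> K" "a2 \<in> K" using K by (auto simp: d1_def d2_def a1_def a2_def)
  have NK: "N A1 \<in> K" "N A2 \<in> K" "N A3 \<in> K" using K by auto
  have "\<Delta> \<in> K" using dK unfolding \<Delta>_def by blast
  then have UVW: "U \<in> K" "V \<in> K" "W \<in> K"
    using dK NK unfolding U_def V_def W_def by blast+
  have \<kappa>: "\<kappa> \<in> K" unfolding \<kappa>_def using K UVW by blast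
  then have c: "c \<in> K" unfolding c_def by blast
  have u: "u \<in> K" unfolding u_def using UVW c by blast
  have "C3 * U \<in> K" using K UVW by blast
  then have r: "r \<in> F" unfolding r_def using \<kappa> K by blast
  have sol: "D = u + V * (B - c) + W * cj (B - c) \<and> B - c \<in> circle r"
    if BD: "(B, D) \<in> common h g (A1, C1) (A2, C2) (A3, C3)" for B D
  proof -
    note e = commonD[OF BD]
    have e1: "N A1 - N A3 + cj a1 * B + a1 * cj B = d1 * D + cj d1 * cj D"
    proof -
      have "N (A1 + B) - N (A3 + B) = Tr (C1 * D) - Tr (C3 * D)" using e by simp
      then show ?thesis by (simp add: a1_def d1_def N_def Tr_def algebra_simps del: uminus_eq)
    qed
    have e2: "N A2 - N A3 + cj a2 * B + a2 * cj B = d2 * D + cj d2 * cj D"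
    proof -
      have "N (A2 + B) - N (A3 + B) = Tr (C2 * D) - Tr (C3 * D)" using e by simp
      then show ?thesis by (simp add: a2_def d2_def N_def Tr_def algebra_simps del: uminus_eq)
    qed
    have "\<Delta> * D = (d1 * D + cj d1 * cj D) * cj d2 - (d2 * D + cj d2 * cj D) * cj d1"
      unfolding \<Delta>_def by (simp add: algebra_simps del: uminus_eq)
    also have "\<dots> = ((N A1 - N A3) * cj d2 - (N A2 - N A3) * cj d1)
        + (cj a1 * cj d2 - cj a2 * cj d1) * B + (a1 * cj d2 - a2 * cj d1) * cj B"
      unfolding e1[symmetric] e2[symmetric] by (simp only: algebra_simps)
    also have "\<dots> = \<Delta> * (U + V * B + W * cj B)"
    proof -
      have "x + y * B + z * cj B = \<Delta> * (x / \<Delta> + y / \<Delta> * B + z / \<Delta> * cj B)" for x y z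
        using \<Delta> by (simp add: distrib_left)
      then show ?thesis unfolding U_def V_def W_def .
    qed
    finally have D: "D = U + V * B + W * cj B" using \<Delta> by simp
    have cD: "cj D = cj U + cj V * cj B + cj W * B" unfolding D using e(1) by simp
    have "N (B - c) = N B + \<kappa> * B + cj \<kappa> * cj B + N \<kappa>"
      using \<kappa> by (simp add: c_def N_def algebra_simps two_eq_0)
    also have "\<dots> = (N (A3 + B) - N A3 - cj A3 * B - A3 * cj B) + \<kappa> * B + cj \<kappa> * cj B + N \<kappa>"
      by (simp add: N_def algebra_simps del: uminus_eq)
    also have "N (A3 + B) = C3 * (U + V * B + W * cj B) + cj C3 * (cj U + cj V * cj B + cj W * B)"
      unfolding e(6) Tr_def cj_mult cD by (simp add: D)
    also have "C3 * (U + V * B + W * cj B) + cj C3 * (cj U + cj V * cj B + cj W * B)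
        - N A3 - cj A3 * B - A3 * cj B + \<kappa> * B + cj \<kappa> * cj B + N \<kappa> = r"
      unfolding r_def Tr_def \<kappa>_def using K UVW by (simp add: algebra_simps del: uminus_eq)
    finally have "B - c \<in> circle r" using e(1) c by (simp add: circle_def del: uminus_eq)
    moreover have "D = u + V * (B - c) + W * cj (B - c)"
      unfolding D u_def by (simp add: algebra_simps del: uminus_eq)
    ultimately show ?thesis by simp
  qed
  let ?Z = "{e \<in> circle r. radius_poly h g (c + e) = N (u + V * e + W * cj e)}"
  let ?f = "\<lambda>y. fst y - c"
  have "inj_on ?f (common h g (A1, C1) (A2, C2) (A3, C3))"
  proof (rule inj_onI)
    fix x y assume xy: "x \<in> common h g (A1, C1) (A2, C2) (A3, C3)" "y \<in> common h g (A1, C1) (A2, C2) (A3, C3)"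
      "fst x - c = fst y - c"
    obtain B D B' D' where BD: "x = (B, D)" "y = (B', D')" by (cases x, cases y)
    have "D = u + V * (fst x - c) + W * cj (fst x - c)" "D' = u + V * (fst y - c) + W * cj (fst y - c)"
      using sol xy(1,2) unfolding BD by simp_all
    with xy(3) show "x = y" unfolding BD by (simp del: uminus_eq)
  qed
  moreover have "?f ` common h g (A1, C1) (A2, C2) (A3, C3) \<subseteq> ?Z"
  proof (rule image_subsetI)
    fix y assume y: "y \<in> common h g (A1, C1) (A2, C2) (A3, C3)"
    obtain B D where BD: "y = (B, D)" by (cases y)
    show "?f y \<in> ?Z" using sol[of B D] commonD(3)[of B D] y unfolding BD by (simp del: uminus_eq)
  qed
  ultimately have le: "card (common h g (A1, C1) (A2, C2) (A3, C3)) \<le> card ?Z"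
    by (intro card_inj_on_le) auto
  show ?thesis
  proof (cases "r = 0")
    case True
    then have "?Z \<subseteq> {0}" by (auto simp: circle_def)
    then have "card ?Z \<le> 1" using card_mono[of "{0}" ?Z] by simp
    with le k show ?thesis by simp
  next
    case False
    then show ?thesis
      using le card_circle_zeros_le[OF h no_root[OF c] g k False r u UVW(2,3)] by linarith
  qed
qed

lemma card_common_same_base:
  assumes K: "B0 \<in> K" and C: "C \<noteq> 0"
    and sub: "\<And>B D. (B, D) \<in> S \<Longrightarrow> B = B0 \<and> D \<in> K \<and> Tr (C * D) = m \<and> N D = n"
  shows "card S \<le> 2"
proof -
  let ?T = "{B0} \<times> {D \<in> K. Tr (C * D) = m \<and> N D = n}"
  have "card S \<le> card ?T" using sub by (intro card_mono) auto
  also have "\<dots> \<le> 2" using card_trace_norm_le[OF C] by (simp add: card_cartesian_product)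
  finally show ?thesis .
qed

text \<open>If there are solutions over \<open>B\<close> and \<open>B0\<close>, translation by
  \<open>B - B0\<close> carries the three distinct points \<open>Ai + B0\<close> from one circle
  about 0 to another. Three points determine a circle, so the translation is trivial and all
  solutions lie over one base point.\<close>

lemma card_common_equal:
  assumes K: "A1 \<in> K" "A2 \<in> K" "A3 \<in> K" "C \<in> K"
    and dist: "A1 \<noteq> A2" "A1 \<noteq> A3" "A2 \<noteq> A3"
  shows "card (common h g (A1, C) (A2, C) (A3, C)) \<le> 2"
proof (cases "common h g (A1, C) (A2, C) (A3, C) = {}")
  case False
  then obtain B0 D0 where "(B0, D0) \<in> common h g (A1, C) (A2, C) (A3, C)" by auto
  note e0 = commonD[OF this]
  have C0: "C \<noteq> 0"
  proof
    assume "C = 0"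
    then have "A1 + B0 = 0" "A2 + B0 = 0" using e0 by (auto simp: Tr_def)
    then show False using dist by (metis add_right_cancel)
  qed
  have same: "B = B0" if BD: "(B, D) \<in> common h g (A1, C) (A2, C) (A3, C)" for B D
  proof -
    note e = commonD[OF BD]
    define z where "z = B - B0"
    let ?S = "{A1 + B0, A2 + B0, A3 + B0}"
    have S: "card ?S \<ge> 3" "?S \<subseteq> circle (Tr (C * D0))"
      using dist e0 K by (auto simp: circle_def)
    have "cj z * x + z * cj x + (Tr (C * D0) + N z - Tr (C * D)) = 0" if "x \<in> ?S" for x
    proof -
      have "N x = Tr (C * D0)" "N (x + z) = Tr (C * D)"
        using that e0 e unfolding z_def by auto
      then show ?thesis by (simp add: N_def algebra_simps del: uminus_eq)
    qed
    from three_points_on_circle[OF S this] show ?thesis by (simp add: z_def del: uminus_eq)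
  qed
  show ?thesis
    by (rule card_common_same_base[OF e0(1) C0, of _ "N (A1 + B0)" "radius_poly h g B0"])
      (use same commonD in metis)
qed simp

text \<open>The real affine relation between the \<open>Ci\<close> eliminates \<open>D\<close>.
  Compared with one fixed solution over \<open>B0\<close>, the quadratic terms in
  \<open>B - B0\<close> cancel because the weights add up to 1, and what remains puts
  \<open>B\<close> on a real line through \<open>B0\<close>.\<close>

lemma card_common_collinear:
  assumes K: "A1 \<in> K" "A2 \<in> K" "A3 \<in> K" "C2 \<in> K" "C3 \<in> K"
    and t: "t \<in> F" "C1 = t * C2 + (1 - t) * C3" and C23: "C2 \<noteq> C3"
    and dist: "(A1, C1) \<noteq> (A2, C2)" "(A1, C1) \<noteq> (A3, C3)"
    and same: "A1 = A2 \<Longrightarrow> A2 = A3 \<Longrightarrow> N C1 = N C2 \<and> N C2 = N C3"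
  shows "card (common h g (A1, C1) (A2, C2) (A3, C3)) \<le> 2 * k"
proof (cases "common h g (A1, C1) (A2, C2) (A3, C3) = {}")
  case False
  let ?S = "common h g (A1, C1) (A2, C2) (A3, C3)"
  from False obtain B0 D0 where BD0: "(B0, D0) \<in> ?S" by auto
  note e0 = commonD[OF BD0]
  define a1 where "a1 = A1 + B0"
  define a2 where "a2 = A2 + B0"
  define a3 where "a3 = A3 + B0"
  have aK: "a1 \<in> K" "a2 \<in> K" "a3 \<in> K" using K e0 by (auto simp: a1_def a2_def a3_def)
  have t1: "1 - t \<in> F" using t by blast
  have rel: "N (A1 + B) = t * N (A2 + B) + (1 - t) * N (A3 + B)" if "(B, D) \<in> ?S" for B D
  proof -
    have "Tr (C1 * D) = Tr (t * (C2 * D) + (1 - t) * (C3 * D))"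
      unfolding t(2) by (simp only: distrib_right mult.assoc)
    also have "\<dots> = t * Tr (C2 * D) + (1 - t) * Tr (C3 * D)"
      using t t1 by (simp only: Tr_add Tr_F_mult)
    finally show ?thesis using commonD[OF that] by simp
  qed
  define \<alpha> where "\<alpha> = a1 - (t * a2 + (1 - t) * a3)"
  \<comment> \<open>\<open>\<alpha>\<close> will be the direction of the line. Were it zero,
    \<open>N_convex\<close> would leave only \<open>t = 0\<close>, \<open>t = 1\<close> or equal
    first coordinates, and each contradicts distinctness, the last one through \<open>same\<close>
    and \<open>N_convex\<close> for the second coordinates.\<close>
  have \<alpha>: "\<alpha> \<noteq> 0"
  proof
    assume "\<alpha> = 0"
    then have a1: "a1 = t * a2 + (1 - t) * a3" by (simp add: \<alpha>_def del: uminus_eq)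
    have "N a1 = t * N a2 + (1 - t) * N a3" using rel[OF BD0] by (simp add: a1_def a2_def a3_def)
    then have "t * (1 - t) * N (a2 - a3) = 0"
      using N_convex[OF t(1) aK(2,3)] a1 by simp
    then consider "t = 0" | "t = 1" | "a2 = a3" by (auto simp del: uminus_eq)
    then show False
    proof cases
      case 1
      then show ?thesis using a1 t(2) dist by (simp add: a1_def a3_def)
    next
      case 2
      then show ?thesis using a1 t(2) dist by (simp add: a1_def a2_def)
    next
      case 3
      then have "A2 = A3" by (simp add: a2_def a3_def)
      moreover have "A1 = A2"
        using a1 3 by (simp add: a1_def a2_def a3_def algebra_simps del: uminus_eq)
      ultimately have NC: "N C1 = N C2" "N C2 = N C3" using same by auto
      have "t * (1 - t) * N (C2 - C3) = 0"
        using N_convex[OF t(1) K(4,5)] NC by (simp add: t(2) algebra_simps del: uminus_eq)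
      then have "t = 0 \<or> t = 1" using C23 by (auto simp del: uminus_eq)
      then show ?thesis using \<open>A1 = A2\<close> \<open>A2 = A3\<close> t(2) dist by auto
    qed
  qed
  have \<alpha>K: "\<alpha> \<in> K" unfolding \<alpha>_def using aK t(1) t1 by blast
  define s where "s B = (B - B0) / \<alpha>" for B
  have B_eq: "B = B0 + s B * \<alpha>" for B using \<alpha> by (simp add: s_def del: uminus_eq)
  have sF: "s B \<in> F" if BD: "(B, D) \<in> ?S" for B D
  proof -
    define z where "z = B - B0"
    note e = commonD[OF BD]
    have zK: "z \<in> K" using e(1) e0(1) by (auto simp: z_def)
    have "N (a1 + z) = t * N (a2 + z) + (1 - t) * N (a3 + z)"
      using rel[OF BD] by (simp add: a1_def a2_def a3_def z_def algebra_simps del: uminus_eq)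
    moreover have "N a1 = t * N a2 + (1 - t) * N a3"
      using rel[OF BD0] by (simp add: a1_def a2_def a3_def)
    moreover have "t * N z + (1 - t) * N z = N z" by (simp add: algebra_simps del: uminus_eq)
    ultimately have "Tr (cj a1 * z) = t * Tr (cj a2 * z) + (1 - t) * Tr (cj a3 * z)"
      unfolding N_add[OF aK(1) zK] N_add[OF aK(2) zK] N_add[OF aK(3) zK]
      by (simp add: algebra_simps del: uminus_eq)
    then have "Tr (cj \<alpha> * z) = 0"
      unfolding \<alpha>_def using aK t by (simp add: Tr_def algebra_simps del: uminus_eq)
    \<comment> \<open>In characteristic two, trace zero means lying in \<open>F\<close>, so the line
      has direction \<open>\<alpha>\<close> itself.\<close>
    then have "cj \<alpha> * z = \<alpha> * cj z" using \<alpha>K by (simp add: Tr_def add_eq_0_iff)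
    then have "cj z / cj \<alpha> = z / \<alpha>" using \<alpha> by (simp add: field_simps del: uminus_eq)
    then show ?thesis by (simp add: F_iff s_def z_def del: uminus_eq)
  qed
  have Ni: "N (A2 + B) = N a2 + Tr (cj a2 * \<alpha>) * s B + N \<alpha> * (s B) ^ 2"
    "N (A3 + B) = N a3 + Tr (cj a3 * \<alpha>) * s B + N \<alpha> * (s B) ^ 2" if "(B, D) \<in> ?S" for B D
  proof -
    have *: "N (x + s B * \<alpha>) = N x + Tr (cj x * \<alpha>) * s B + N \<alpha> * (s B) ^ 2" if "x \<in> K" for x
      using that \<alpha>K sF[OF \<open>(B, D) \<in> ?S\<close>] by (simp add: N_def Tr_def algebra_simps power2_eq_square)
    have "A2 + B = a2 + s B * \<alpha>" "A3 + B = a3 + s B * \<alpha>"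
      unfolding a2_def a3_def add.assoc B_eq[symmetric] by (rule refl)+
    with * aK show "N (A2 + B) = N a2 + Tr (cj a2 * \<alpha>) * s B + N \<alpha> * (s B) ^ 2"
      "N (A3 + B) = N a3 + Tr (cj a3 * \<alpha>) * s B + N \<alpha> * (s B) ^ 2" by simp_all
  qed
  \<comment> \<open>If this determinant is nonzero, Cramer's rule makes \<open>D\<close> a
    polynomial of degree at most two in the real parameter \<open>s\<close>, and
    \<open>card_line_zeros_le\<close> applies.\<close>
  define \<Delta> where "\<Delta> = C2 * cj C3 - cj C2 * C3"
  show ?thesis
  proof (cases "\<Delta> = 0")
    case False
    define d where "d x2 x3 = (x2 * cj C3 - x3 * cj C2) / \<Delta>" for x2 x3
    define d0 where "d0 = d (N a2) (N a3)"
    define d1 where "d1 = d (Tr (cj a2 * \<alpha>)) (Tr (cj a3 * \<alpha>))"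
    define d2 where "d2 = d (N \<alpha>) (N \<alpha>)"
    have D: "D = d0 + d1 * s B + d2 * (s B) ^ 2" if BD: "(B, D) \<in> ?S" for B D
    proof -
      note e = commonD[OF BD]
      have "\<Delta> * D = Tr (C2 * D) * cj C3 - Tr (C3 * D) * cj C2"
        by (simp add: \<Delta>_def Tr_def algebra_simps del: uminus_eq)
      then have "D = d (N (A2 + B)) (N (A3 + B))"
        using False e by (simp add: d_def field_simps del: uminus_eq)
      also have "\<dots> = d0 + d1 * s B + d2 * (s B) ^ 2"
      proof -
        have "d (x + y * p + z * r) (x' + y' * p + z' * r) = d x x' + d y y' * p + d z z' * r" for x y z x' y' z' p r
          by (simp only: d_def regroup_linear_combination add_divide_distrib times_divide_eq_left)
        then show ?thesis unfolding Ni[OF BD] d0_def d1_def d2_def by blast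
      qed
      finally show ?thesis .
    qed
    let ?Z = "{s \<in> F. radius_poly h g (B0 + s * \<alpha>) = N (d0 + d1 * s + d2 * s ^ 2)}"
    have "inj_on (\<lambda>y. s (fst y)) ?S"
    proof (rule inj_onI)
      fix x y assume xy: "x \<in> ?S" "y \<in> ?S" "s (fst x) = s (fst y)"
      then have "fst x = fst y" using B_eq by metis
      with xy show "x = y" using D by (metis prod.collapse)
    qed
    moreover have "(\<lambda>y. s (fst y)) ` ?S \<subseteq> ?Z"
    proof (rule image_subsetI)
      fix y assume y: "y \<in> ?S"
      obtain B D where BD: "y = (B, D)" by (cases y)
      show "s (fst y) \<in> ?Z"
        using y D[of B D] sF[of B D] commonD(3)[of B D] B_eq[of B] unfolding BD by simp
    qed
    ultimately have "card ?S \<le> card ?Z" by (intro card_inj_on_le) auto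
    also have "\<dots> \<le> 2 * k" by (rule card_line_zeros_le[OF h g k \<alpha>])
    finally show ?thesis .
  next
    case True
    show ?thesis
    proof (cases "C3 = 0")
      case C3: True
      have "card ?S \<le> 2"
      proof (rule card_common_same_base[OF K(3), of C2 _ "N (A2 + A3)" "radius_poly h g A3"])
        show "C2 \<noteq> 0" using C3 C23 by simp
        fix B D assume BD: "(B, D) \<in> ?S"
        note e = commonD[OF BD]
        have "N (A3 + B) = 0" using e(6) C3 by (simp add: Tr_def)
        then have "B = A3" by (simp add: add_eq_0_iff)
        with e show "B = A3 \<and> D \<in> K \<and> Tr (C2 * D) = N (A2 + A3) \<and> N D = radius_poly h g A3" by simp
      qed
      with k show ?thesis by simp
    next
      case C3: False
      \<comment> \<open>Here \<open>C2\<close> is a real multiple of \<open>C3\<close> by a factor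
        \<open>c\<close> other than 1. Eliminating \<open>D\<close> gives a quadratic for
        \<open>s\<close> with leading coefficient \<open>(1 - c) * N \<alpha>\<close>, hence at most
        two base points, each with at most two values of \<open>D\<close>.\<close>
      define c where "c = C2 / C3"
      have c1: "c \<noteq> 1" using C3 C23 by (simp add: c_def)
      have "cj c = c" using True C3 by (simp add: c_def \<Delta>_def field_simps del: uminus_eq)
      then have cF: "c \<in> F" by (simp add: F_iff)
      have C2: "C2 = c * C3" using C3 by (simp add: c_def)
      let ?p = "[:N a2 - c * N a3, Tr (cj a2 * \<alpha>) - c * Tr (cj a3 * \<alpha>), (1 - c) * N \<alpha>:]"
      have nz: "?p \<noteq> 0" using c1 \<alpha> by (simp del: uminus_eq)
      let ?R = "{x. poly ?p x = 0}"
      have R: "finite ?R" "card ?R \<le> 2"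
        using poly_roots_finite[OF nz] card_poly_roots_bound[OF nz] by (auto intro: order_trans)
      have root: "s B \<in> ?R" if BD: "(B, D) \<in> ?S" for B D
      proof -
        note e = commonD[OF BD]
        have "Tr (C2 * D) = c * Tr (C3 * D)"
          unfolding C2 mult.assoc using cF by (rule Tr_F_mult)
        then have "N (A2 + B) = c * N (A3 + B)" using e by simp
        then show ?thesis unfolding Ni[OF BD]
          by (simp add: algebra_simps power2_eq_square del: uminus_eq)
      qed
      let ?T = "SIGMA x:?R. {D \<in> K. Tr (C3 * D) = N (A3 + (B0 + x * \<alpha>)) \<and> N D = radius_poly h g (B0 + x * \<alpha>)}"
      have finT: "finite ?T" using R by (intro finite_SigmaI) auto
      have "card ?T = (\<Sum>x\<in>?R. card {D \<in> K. Tr (C3 * D) = N (A3 + (B0 + x * \<alpha>)) \<and> N D = radius_poly h g (B0 + x * \<alpha>)})"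
        using R by (intro card_SigmaI) auto
      also have "\<dots> \<le> (\<Sum>x\<in>?R. 2)"
        by (rule sum_mono) (rule card_trace_norm_le[OF C3])
      also have "\<dots> \<le> 4" using R by simp
      finally have T: "card ?T \<le> 4" .
      have "inj_on (\<lambda>y. (s (fst y), snd y)) ?S"
        by (rule inj_onI) (metis B_eq prod.collapse prod.inject)
      moreover have "(\<lambda>y. (s (fst y), snd y)) ` ?S \<subseteq> ?T"
      proof (rule image_subsetI)
        fix y assume y: "y \<in> ?S"
        obtain B D where BD: "y = (B, D)" by (cases y)
        show "(s (fst y), snd y) \<in> ?T"
          using y root[of B D] commonD[of B D] B_eq[of B] unfolding BD by simp
      qed
      ultimately have "card ?S \<le> card ?T" using finT by (intro card_inj_on_le)
      with T k show ?thesis by simp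
    qed
  qed
qed simp

lemma common_swap: "common h g x1 x2 x3 = common h g x2 x1 x3"
  by (auto simp: common_def)

text \<open>The cases are \<open>C1\<close>, \<open>C2\<close>, \<open>C3\<close> affinely
  independent over \<open>F\<close>, all equal, or collinear; if \<open>C2 = C3\<close> only, the
  first two points are exchanged and \<open>t = 0\<close>. The three points may lie on a different
  surface from their neighbours; it supplies equal norms of second coordinates over equal first
  ones.\<close>

lemma card_common_le:
  assumes x: "x1 \<in> surface h' g'" "x2 \<in> surface h' g'" "x3 \<in> surface h' g'"
    and dist: "x1 \<noteq> x2" "x1 \<noteq> x3" "x2 \<noteq> x3"
  shows "card (common h g x1 x2 x3) \<le> 2 * k"
proof -
  obtain A1 C1 where x1: "x1 = (A1, C1)" by (cases x1)
  obtain A2 C2 where x2: "x2 = (A2, C2)" by (cases x2)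
  obtain A3 C3 where x3: "x3 = (A3, C3)" by (cases x3)
  have K: "A1 \<in> K" "A2 \<in> K" "A3 \<in> K" "C1 \<in> K" "C2 \<in> K" "C3 \<in> K"
    and n: "N C1 = radius_poly h' g' A1" "N C2 = radius_poly h' g' A2" "N C3 = radius_poly h' g' A3"
    using x by (auto simp: x1 x2 x3 surface_def)
  let ?\<Delta> = "(C1 - C3) * cj (C2 - C3) - cj (C1 - C3) * (C2 - C3)"
  consider "?\<Delta> \<noteq> 0" | "C2 = C3" "C1 = C3" | "?\<Delta> = 0" "C2 \<noteq> C3" | "C2 = C3" "C1 \<noteq> C3" by blast
  then show ?thesis
  proof cases
    case 1
    then show ?thesis unfolding x1 x2 x3 using K by (intro card_common_independent)
  next
    case 2
    then have "card (common h g x1 x2 x3) \<le> 2"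
      unfolding x1 x2 x3 using K dist x1 x2 x3 by (simp add: card_common_equal)
    then show ?thesis using k by simp
  next
    case 3
    define t where "t = (C1 - C3) / (C2 - C3)"
    have "cj t = t" using 3 by (simp add: t_def field_simps del: uminus_eq cj_diff)
    then have "t \<in> F" by (simp add: F_iff)
    moreover have "C1 - C3 = t * (C2 - C3)" using 3 by (simp add: t_def del: uminus_eq)
    then have "C1 = t * C2 + (1 - t) * C3" by (simp add: algebra_simps del: uminus_eq)
    ultimately show ?thesis
      unfolding x1 x2 x3 using K 3 dist n x1 x2 x3 by (intro card_common_collinear[of _ _ _ _ _ t]) auto
  next
    case 4
    have "card (common h g (A2, C2) (A1, C1) (A3, C3)) \<le> 2 * k"
      using K 4 dist n x1 x2 x3 by (intro card_common_collinear[of _ _ _ _ _ 0]) auto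
    then show ?thesis unfolding x1 x2 x3 by (simp only: common_swap[of "(A1, C1)"])
  qed
qed

end

section \<open>Polynomials with many zeros on a circle\<close>

definition polys :: "nat \<Rightarrow> 'a poly set" where
  "polys k = {g. degree g < k \<and> (\<forall>i. coeff g i \<in> K)}"

lemma bij_betw_polys:
  assumes "k > 0"
  shows "bij_betw (\<lambda>g. map (coeff g) [0..<k]) (polys k) {xs. set xs \<subseteq> K \<and> length xs = k}"
proof (rule bij_betw_byWitness[of _ Poly])
  show "\<forall>g\<in>polys k. Poly (map (coeff g) [0..<k]) = g"
    by (auto simp: polys_def poly_eq_iff coeff_Poly_eq nth_default_def coeff_eq_0)
  show "\<forall>xs\<in>{xs. set xs \<subseteq> K \<and> length xs = k}. map (coeff (Poly xs)) [0..<k] = xs"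
    by (auto simp: coeff_Poly_eq nth_default_def intro!: nth_equalityI)
  show "(\<lambda>g. map (coeff g) [0..<k]) ` polys k \<subseteq> {xs. set xs \<subseteq> K \<and> length xs = k}"
    by (auto simp: polys_def)
  show "Poly ` {xs. set xs \<subseteq> K \<and> length xs = k} \<subseteq> polys k"
  proof (rule image_subsetI)
    fix xs assume xs: "xs \<in> {xs. set xs \<subseteq> K \<and> length xs = k}"
    have "degree (Poly xs) < k"
      using xs assms by (cases "Poly xs = 0") (auto intro!: degree_lessI simp: coeff_Poly_eq nth_default_def)
    with xs show "Poly xs \<in> polys k"
      by (auto simp: polys_def coeff_Poly_eq nth_default_def)
  qed
qed

lemma finite_polys: "k > 0 \<Longrightarrow> finite (polys k)"
  using bij_betw_finite[OF bij_betw_polys] finite_lists_length_eq[OF finite_K] by blast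

lemma card_polys: "k > 0 \<Longrightarrow> card (polys k) = q ^ (2 * k)"
  using bij_betw_same_card[OF bij_betw_polys]
  by (simp add: card_lists_length_eq card_K power_mult power2_eq_square)

lemma poly_K: "\<forall>i. coeff p i \<in> K \<Longrightarrow> x \<in> K \<Longrightarrow> poly p x \<in> K"
proof (induction p)
  case (pCons a p)
  have "a \<in> K" "\<forall>i. coeff p i \<in> K"
    using spec[OF pCons.prems(1), of 0] pCons.prems(1)[rule_format, of "Suc _"] by auto
  with pCons show ?case by auto
qed simp

lemma poly_polys_K: "g \<in> polys k \<Longrightarrow> x \<in> K \<Longrightarrow> poly g x \<in> K"
  by (simp add: polys_def poly_K)


text \<open>After multiplication by \<open>e ^ (k - 1)\<close> the trace becomes a polynomial
  \<open>E\<close> of degree at most \<open>2 * k - 2\<close> with \<open>2 * k - 1\<close> zeros,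
  hence zero. Its upper coefficients are those of the shifted polynomial \<open>D\<close>, and its
  middle one is the trace of the constant term of \<open>D\<close>.\<close>

lemma trace_zero_on_circle:
  assumes r: "r \<noteq> 0" and d: "degree d < k" and S: "S \<subseteq> circle r" "card S \<ge> 2 * k - 1"
    and z: "\<And>e. e \<in> S \<Longrightarrow> Tr (poly d (c + e)) = 0"
  obtains z where "d = [:z:]" "z \<in> F"
proof -
  define D where "D = pcompose d [:c, 1:]"
  define m where "m = k - 1"
  have D: "degree D \<le> m" using d by (simp add: D_def m_def)
  define E where "E = monom 1 m * D + rv m r D"
  have "degree (monom 1 m * D) \<le> m + m"
    by (rule order_trans[OF degree_mult_le]) (use D in \<open>simp add: degree_monom_eq\<close>)
  then have dE: "degree E \<le> 2 * m"
    unfolding E_def using degree_rv[of m r D] by (intro degree_add_le) auto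
  have "E = 0"
  proof (rule ccontr)
    assume nz: "E \<noteq> 0"
    have "card S \<le> card {x. poly E x = 0}"
    proof (intro card_mono poly_roots_finite nz subsetI)
      fix e assume e: "e \<in> S"
      have "poly E e = e ^ m * Tr (poly d (c + e))"
        using poly_rv[OF _ r D, of e] e S(1)
        by (auto simp: E_def D_def poly_monom Tr_def algebra_simps)
      then show "e \<in> {x. poly E x = 0}" using z[OF e] by simp
    qed
    also have "\<dots> \<le> degree E" by (rule card_poly_roots_bound[OF nz])
    finally show False using dE S(2) d by (simp add: m_def)
  qed
  then have E: "coeff E i = 0" for i by simp
  have Em: "coeff E (m + i) = coeff D i + (if i = 0 then cj (coeff D 0) else 0)" for i
    by (simp add: E_def coeff_monom_mult coeff_rv)
  have "coeff D i = 0" if "i > 0" for i using E[of "m + i"] Em[of i] that by simp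
  then have "degree D \<le> 0" by (intro degree_le) simp
  then have "degree d = 0" by (simp add: D_def)
  then obtain w where w: "d = [:w:]" by (rule degree_eq_zeroE)
  then have "D = [:w:]" by (simp add: D_def)
  then have "w + cj w = 0" using E[of m] Em[of 0] by simp
  then have "w \<in> F" by (simp add: F_iff add_eq_0_iff)
  with w show ?thesis using that by blast
qed

text \<open>Each fibre of the evaluation map has at most \<open>q\<close> elements, and comparing the numbers of polynomials
  and of value tuples leaves no room for a smaller one.\<close>

lemma card_interpolation:
  assumes r: "r \<noteq> 0" and c: "c \<in> K" and k: "k > 0"
    and es: "set es \<subseteq> circle r" "distinct es" "length es = 2 * k - 1"
    and t: "\<And>e. e \<in> set es \<Longrightarrow> t e \<in> F"
  shows "card {g \<in> polys k. \<forall>e\<in>set es. Tr (poly g (c + e)) = t e} = q"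
proof -
  let ?f = "\<lambda>g. map (\<lambda>e. Tr (poly g (c + e))) es"
  let ?B = "{xs. set xs \<subseteq> F \<and> length xs = 2 * k - 1}"
  have finB: "finite ?B" by (rule finite_lists_length_eq) simp
  have ceK: "c + e \<in> K" if "e \<in> set es" for e using that es(1) c by (auto simp: circle_def)
  have fB: "?f ` polys k \<subseteq> ?B" using es(3) ceK poly_polys_K by auto
  have "card {g \<in> polys k. ?f g = map t es} = q"
  proof (rule fibre_card_eq[OF finite_polys[OF k] finB fB])
    show "card (polys k) = q * card ?B"
      using k by (simp add: card_polys card_lists_length_eq card_F flip: power_Suc)
    show "map t es \<in> ?B" using t es(3) by auto
    fix b
    show "card {g \<in> polys k. ?f g = b} \<le> q"
    proof (cases "{g \<in> polys k. ?f g = b} = {}")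
      case False
      then obtain g0 where g0: "g0 \<in> polys k" "?f g0 = b" by auto
      have "{g \<in> polys k. ?f g = b} \<subseteq> (\<lambda>z. g0 + [:z:]) ` F"
      proof
        fix g assume "g \<in> {g \<in> polys k. ?f g = b}"
        then have g: "g \<in> polys k" "?f g = ?f g0" using g0 by auto
        have "degree (g - g0) < k" using g g0 k by (intro degree_diff_less) (auto simp: polys_def)
        moreover have "card (set es) \<ge> 2 * k - 1" using es by (simp add: distinct_card)
        moreover have "Tr (poly (g - g0) (c + e)) = 0" if "e \<in> set es" for e
        proof -
          have "Tr (poly g (c + e)) = Tr (poly g0 (c + e))" using g(2) that by (simp add: map_eq_conv)
          then show ?thesis by (simp add: Tr_def algebra_simps del: uminus_eq)
        qed
        ultimately obtain z where "g - g0 = [:z:]" "z \<in> F"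
          using trace_zero_on_circle[OF r _ es(1)] by metis
        moreover have "g = g0 + (g - g0)" by simp
        ultimately show "g \<in> (\<lambda>z. g0 + [:z:]) ` F" by (metis image_eqI)
      qed
      then have "card {g \<in> polys k. ?f g = b} \<le> card F" by (rule surj_card_le[OF finite_F])
      then show ?thesis by (simp add: card_F)
    qed (simp only: card.empty le0)
  qed
  also have "{g \<in> polys k. ?f g = map t es} = {g \<in> polys k. \<forall>e\<in>set es. Tr (poly g (c + e)) = t e}"
    by (simp add: map_eq_conv)
  finally show ?thesis .
qed

lemma prod_list_circle: "set es \<subseteq> circle r \<Longrightarrow> prod_list es \<in> K \<and> N (prod_list es) = r ^ length es"
  by (induction es) (auto simp: circle_def simp del: N_simps(6))

definition circle_zeros :: "'a poly \<Rightarrow> 'a \<Rightarrow> 'a \<Rightarrow> 'a \<Rightarrow> 'a \<Rightarrow> 'a \<Rightarrow> 'a poly \<Rightarrow> 'a set" where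
  "circle_zeros h c r u v w g = {e \<in> circle r. radius_poly h g (c + e) = N (u + v * e + w * cj e)}"

lemma finite_circle_zeros [simp]: "finite (circle_zeros h c r u v w g)"
  by (simp add: circle_zeros_def)

context
  fixes h :: "'a poly" and k :: nat and c r u v w :: 'a
  assumes h: "degree h = k" "lead_coeff h = 1" "\<forall>i. coeff h i \<in> K" "poly h c \<noteq> 0" and k: "k \<ge> 3"
    and r: "r \<noteq> 0" "r \<in> F" and K: "c \<in> K" "u \<in> K" "v \<in> K" "w \<in> K"
begin

abbreviation "Z \<equiv> circle_zeros h c r u v w"

text \<open>The product of all \<open>2 * k\<close> roots, with multiplicity, of the polynomial from
  \<open>circle_poly\<close>. Dividing it by \<open>2 * k - 1\<close> known zeros gives the last
  one.\<close>

definition last_zero :: 'a where "last_zero = poly h c * r ^ k / cj (poly h c)"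

lemma last_zero: "last_zero \<in> K" "N last_zero = r ^ (2 * k)"
proof -
  have hK: "poly h c \<in> K" using h(3) K(1) by (rule poly_K)
  then show "last_zero \<in> K" unfolding last_zero_def using r by blast
  show "N last_zero = r ^ (2 * k)"
    unfolding last_zero_def using hK h(4) r by (simp flip: power_mult)
qed

text \<open>The remaining root \<open>y\<close> from Vieta's formula has norm
  \<open>r ^ (2 * k) / r ^ (2 * k - 1) = r\<close>, so it lies on the circle as well, and
  \<open>new\<close> says that it is not in the list.\<close>

lemma card_Z_ge:
  assumes g: "degree g < k" and es: "set es \<subseteq> Z g" "distinct es" "length es = 2 * k - 1"
    and new: "\<And>x. x \<in> set es \<Longrightarrow> x * prod_list es \<noteq> last_zero"
  shows "card (Z g) \<ge> 2 * k"
proof -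
  obtain E where E: "degree E = 2 * k" "lead_coeff E = cj (poly h c)" "poly E 0 = poly h c * r ^ k"
    "\<And>e. e \<in> circle r \<Longrightarrow> poly E e = e ^ k * (radius_poly h g (c + e) - N (u + v * e + w * cj e))"
    using circle_poly[OF h(1,2,4) g k r K(2-4)] by metis
  have circ: "set es \<subseteq> circle r" using es(1) by (auto simp: circle_zeros_def)
  have pnz: "prod_list es \<noteq> 0" "0 \<notin> set es"
    using circ circle_nonzero[OF _ r(1)] by (auto simp: prod_list_zero_iff)
  define y where "y = last_zero / prod_list es"
  have "poly E (poly E 0 / (lead_coeff E * prod_list es)) = 0"
  proof (rule last_root[OF es(2) _ _ pnz(2)])
    show "poly E x = 0" if "x \<in> set es" for x
    proof -
      have "x \<in> circle r" "radius_poly h g (c + x) = N (u + v * x + w * cj x)"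
        using that es(1) by (auto simp: circle_zeros_def)
      then show ?thesis using E(4) by (simp del: uminus_eq)
    qed
    show "degree E = Suc (length es)" "odd (length es)" using E(1) es(3) k by auto
  qed
  then have y0: "poly E y = 0"
    unfolding E(2,3) y_def last_zero_def by (simp add: field_simps)
  have "y \<in> K" unfolding y_def using last_zero prod_list_circle[OF circ] by blast
  moreover have "N y = r"
  proof -
    have "N y = r ^ (2 * k) / r ^ (2 * k - 1)"
      unfolding y_def using last_zero prod_list_circle[OF circ] es(3) by simp
    also have "\<dots> = r ^ (2 * k - (2 * k - 1))" using r(1) by (simp add: power_diff)
    also have "2 * k - (2 * k - 1) = 1" using k by simp
    finally show ?thesis by simp
  qed
  ultimately have "y \<in> circle r" by (simp add: circle_def)
  with y0 E(4)[of y] circle_nonzero[OF _ r(1), of y] have yZ: "y \<in> Z g"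
    by (simp add: circle_zeros_def del: uminus_eq)
  have "y \<notin> set es"
    using new[of y] pnz by (auto simp: y_def)
  then have "card (insert y (set es)) = 2 * k"
    using es k by (simp add: distinct_card)
  moreover have "insert y (set es) \<subseteq> Z g" using yZ es(1) by simp
  ultimately show ?thesis using card_mono[of "Z g" "insert y (set es)"] by simp
qed

lemma card_Z_le: "degree g < k \<Longrightarrow> card (Z g) \<le> 2 * k"
  unfolding circle_zeros_def using card_circle_zeros_le[OF h(1,2,4) _ k r K(2-4)] .

definition tuples :: "'a list set" where
  "tuples = {es. set es \<subseteq> circle r \<and> distinct es \<and> length es = 2 * k - 1 \<and>
     (\<forall>x\<in>set es. x * prod_list es \<noteq> last_zero)}"

lemma square_inj: "x * x = y * y \<Longrightarrow> x = (y::'a)"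
proof -
  assume "x * x = y * y"
  then have "(x - y) * (x + y) = 0" by (simp add: algebra_simps del: uminus_eq)
  then show "x = y" by (auto simp: add_eq_0_iff)
qed

lemma card_tuples:
  assumes q: "q \<ge> 8 * k"
  shows "card tuples \<ge> (q - 4 * k) ^ (2 * k - 1)"
proof -
  define T0 where "T0 = {xs. set xs \<subseteq> circle r \<and> distinct xs \<and> length xs = 2 * k - 2}"
  have finT0: "finite T0"
    unfolding T0_def by (rule finite_subset[OF _ finite_lists_length_eq[OF finite_circle[of r], of "2 * k - 2"]]) auto
  \<comment> \<open>An admissible list of \<open>2 * k - 2\<close> points is extended by
    \<open>y\<close>. The three sets exclude that \<open>y\<close> repeats an entry, that the last
    root repeats an entry, and that the last root is \<open>y\<close>. Squaring is injective in
    characteristic two, so the third has at most one element.\<close>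
  define bad where "bad xs = set xs \<union> (\<lambda>x. last_zero / (prod_list xs * x)) ` set xs
    \<union> {y. y * y = last_zero / prod_list xs}" for xs
  have bad: "finite (bad xs)" "card (bad xs) \<le> 4 * k" if "xs \<in> T0" for xs
  proof -
    have s: "finite {y. y * y = last_zero / prod_list xs} \<and> card {y. y * y = last_zero / prod_list xs} \<le> 1"
    proof (cases "{y. y * y = last_zero / prod_list xs} = {}")
      case False
      then obtain y0 where y0: "y0 * y0 = last_zero / prod_list xs" by auto
      have "{y. y * y = last_zero / prod_list xs} = {y0}"
        unfolding y0[symmetric] using square_inj by blast
      then show ?thesis by simp
    qed simp
    then show "finite (bad xs)" by (simp add: bad_def)
    have "card (bad xs) \<le> card (set xs) + card ((\<lambda>x. last_zero / (prod_list xs * x)) ` set xs) + 1"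
      unfolding bad_def using s by (intro order_trans[OF card_Un_le] add_mono card_Un_le) simp_all
    also have "\<dots> \<le> (2 * k - 2) + (2 * k - 2) + 1"
      using that by (intro add_mono order_trans[OF card_image_le]) (auto simp: T0_def card_length intro: order_trans[OF card_length])
    finally show "card (bad xs) \<le> 4 * k" using k by simp
  qed
  have T0: "card T0 \<ge> (q - 4 * k) ^ (2 * k - 2)"
  proof -
    have "card T0 = \<Prod>{card (circle r) - (2 * k - 2) + 1..card (circle r)}"
      unfolding T0_def using q card_circle[OF r(2,1)]
      by (subst card_lists_distinct_length_eq[symmetric]) (auto intro!: arg_cong[of _ _ card])
    also have "\<dots> \<ge> (\<Prod>i\<in>{card (circle r) - (2 * k - 2) + 1..card (circle r)}. q - 4 * k)"
      using card_circle[OF r(2,1)] by (intro prod_mono) auto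
    finally show ?thesis using card_circle[OF r(2,1)] q by (simp add: Suc_diff_le)
  qed
  let ?D = "SIGMA xs:T0. circle r - bad xs"
  have fin: "finite tuples"
    unfolding tuples_def by (rule finite_subset[OF _ finite_lists_length_eq[OF finite_circle[of r], of "2 * k - 1"]]) auto
  have "(q - 4 * k) ^ (2 * k - 1) = (q - 4 * k) ^ (2 * k - 2) * (q - 4 * k)"
  proof -
    have "2 * k - 1 = Suc (2 * k - 2)" using k by simp
    then show ?thesis by (simp only: power_Suc mult.commute)
  qed
  also have "\<dots> \<le> card T0 * (q - 4 * k)" using T0 by simp
  also have "\<dots> = (\<Sum>xs\<in>T0. q - 4 * k)" by simp
  also have "\<dots> \<le> (\<Sum>xs\<in>T0. card (circle r - bad xs))"
  proof (rule sum_mono)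
    fix xs assume "xs \<in> T0"
    then show "q - 4 * k \<le> card (circle r - bad xs)"
      using bad[of xs] diff_card_le_card_Diff[of "bad xs" "circle r"] card_circle[OF r(2,1)] by simp
  qed
  also have "\<dots> = card ?D" using finT0 by (subst card_SigmaI) auto
  also have "\<dots> \<le> card tuples"
  proof (rule card_inj_on_le[of "\<lambda>(xs, y). y # xs"])
    show "inj_on (\<lambda>(xs, y). y # xs) ?D" by (auto intro!: inj_onI)
    show "(\<lambda>(xs, y). y # xs) ` ?D \<subseteq> tuples"
    proof clarify
      fix xs y assume xs: "xs \<in> T0" and y: "y \<in> circle r" "y \<notin> bad xs"
      have circ: "set xs \<subseteq> circle r" using xs by (simp add: T0_def)
      then have nz: "prod_list xs \<noteq> 0" "x \<in> set xs \<Longrightarrow> x \<noteq> 0" for x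
        using circle_nonzero[OF _ r(1)] by (auto simp: prod_list_zero_iff)
      have "x * prod_list (y # xs) \<noteq> last_zero" if "x \<in> set (y # xs)" for x
      proof (cases "x = y")
        case True
        then show ?thesis using y(2) nz by (auto simp: bad_def field_simps)
      next
        case False
        then have "x \<in> set xs" using that by simp
        then have "y \<noteq> last_zero / (prod_list xs * x)" "x \<noteq> 0" using y(2) nz by (auto simp: bad_def)
        then show ?thesis using nz by (auto simp: field_simps)
      qed
      then show "y # xs \<in> tuples"
        using xs y k by (auto simp: tuples_def T0_def bad_def)
    qed
  qed (rule fin)
  finally show ?thesis .
qed

text \<open>Double counting of tuples inside zero sets: by interpolation each tuple serves exactly
  \<open>q\<close> polynomials, while a polynomial with at least one tuple has \<open>2 * k\<close>
  zeros and at most \<open>(2 * k) ^ (2 * k - 1)\<close> tuples. The assumption on \<open>q\<close>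
  gives \<open>q \<le> 2 * (q - 4 * k)\<close>.\<close>

lemma card_many_zeros:
  assumes q: "q \<ge> 8 * k"
  shows "q ^ (2 * k) \<le> card {g \<in> polys k. card (Z g) \<ge> 2 * k} * (4 * k) ^ (2 * k - 1)"
proof -
  let ?good = "{g \<in> polys k. card (Z g) \<ge> 2 * k}"
  have k0: "k > 0" using k by simp
  have finT: "finite tuples"
    unfolding tuples_def by (rule finite_subset[OF _ finite_lists_length_eq[OF finite_circle[of r], of "2 * k - 1"]]) auto
  have finP: "finite (polys k)" by (rule finite_polys[OF k0])
  have "card tuples * q = (\<Sum>es\<in>tuples. card {g \<in> polys k. set es \<subseteq> Z g})"
  proof -
    have "card {g \<in> polys k. set es \<subseteq> Z g} = q" if es: "es \<in> tuples" for es
    proof -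
      have circ: "set es \<subseteq> circle r" using es by (simp add: tuples_def)
      let ?t = "\<lambda>e. N (u + v * e + w * cj e) - N (poly h (c + e))"
      have "{g \<in> polys k. set es \<subseteq> Z g} = {g \<in> polys k. \<forall>e\<in>set es. Tr (poly g (c + e)) = ?t e}"
        using circ by (auto simp: circle_zeros_def radius_poly_def algebra_simps subset_iff simp del: uminus_eq)
      also have "card \<dots> = q"
      proof (rule card_interpolation[OF r(1) K(1) k0 circ])
        show "distinct es" "length es = 2 * k - 1" using es by (auto simp: tuples_def)
        fix e assume "e \<in> set es"
        then have "e \<in> K" using circ by (auto simp: circle_def)
        then show "?t e \<in> F" using K h(3) poly_K by blast
      qed
      finally show ?thesis .
    qed
    then show ?thesis by simp
  qed
  also have "\<dots> = (\<Sum>g\<in>polys k. card {es \<in> tuples. set es \<subseteq> Z g})"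
    using finT finP by (rule sum_multicount_gen[OF _ _ ]) auto
  also have "\<dots> \<le> (\<Sum>g\<in>polys k. if g \<in> ?good then (2 * k) ^ (2 * k - 1) else 0)"
  proof (rule sum_mono)
    fix g assume g: "g \<in> polys k"
    then have dg: "degree g < k" by (simp add: polys_def)
    show "card {es \<in> tuples. set es \<subseteq> Z g} \<le> (if g \<in> ?good then (2 * k) ^ (2 * k - 1) else 0)"
    proof (cases "{es \<in> tuples. set es \<subseteq> Z g} = {}")
      case False
      then obtain es where "es \<in> tuples" "set es \<subseteq> Z g" by auto
      then have good: "g \<in> ?good" using g card_Z_ge[OF dg, of es] by (auto simp: tuples_def)
      have "card {es \<in> tuples. set es \<subseteq> Z g} \<le> card {es. set es \<subseteq> Z g \<and> length es = 2 * k - 1}"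
        by (intro card_mono finite_lists_length_eq) (auto simp: tuples_def)
      also have "\<dots> = card (Z g) ^ (2 * k - 1)" by (simp add: card_lists_length_eq)
      also have "\<dots> \<le> (2 * k) ^ (2 * k - 1)" using card_Z_le[OF dg] by (rule power_mono) simp
      finally show ?thesis using good by simp
    qed (simp only: card.empty le0)
  qed
  also have "\<dots> = card ?good * (2 * k) ^ (2 * k - 1)"
    using finP by (simp add: sum.If_cases Int_def)
  finally have 1: "card tuples * q \<le> card ?good * (2 * k) ^ (2 * k - 1)" .
  have "q ^ (2 * k) = q ^ (2 * k - 1) * q"
    using k power_add[of q "2 * k - 1" 1] by simp
  also have "\<dots> \<le> (2 * (q - 4 * k)) ^ (2 * k - 1) * q"
    using q by (intro mult_right_mono power_mono) auto
  also have "\<dots> \<le> 2 ^ (2 * k - 1) * (card tuples * q)"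
    using card_tuples[OF q] by (simp add: power_mult_distrib)
  also have "\<dots> \<le> 2 ^ (2 * k - 1) * (card ?good * (2 * k) ^ (2 * k - 1))" using 1 by simp
  also have "\<dots> = card ?good * (2 * (2 * k)) ^ (2 * k - 1)"
    by (simp only: power_mult_distrib mult_ac)
  also have "2 * (2 * k) = 4 * k" by simp
  finally show ?thesis .
qed

end

section \<open>Counting copies\<close>

text \<open>The map \<open>x ^ k - x ^ (k - 1)\<close> agrees at 0 and 1, so on the finite set
  \<open>K\<close> it is not injective and hence not surjective; subtracting a missed value gives
  \<open>h\<close>.\<close>

lemma ex_rootless_poly:
  assumes k: "k \<ge> 2"
  shows "\<exists>h. degree h = k \<and> lead_coeff h = 1 \<and> (\<forall>i. coeff h i \<in> K) \<and> (\<forall>x\<in>K. poly h x \<noteq> 0)"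
proof -
  let ?f = "\<lambda>x::'a. x ^ k - x ^ (k - 1)"
  have "?f 0 = ?f 1" using k by (simp add: power_0_left)
  then have "\<not> inj_on ?f K" using inj_onD[of ?f K 0 1] K_closed(1,2) zero_neq_one by blast
  moreover have "?f ` K \<subseteq> K" by auto
  ultimately have "?f ` K \<noteq> K" using finite_surj_inj[of K ?f] by auto
  then obtain b where b: "b \<in> K" "b \<notin> ?f ` K" using \<open>?f ` K \<subseteq> K\<close> by blast
  define h where "h = monom 1 k - monom 1 (k - 1) - [:b:]"
  have co: "coeff h k = 1" using k by (simp add: h_def coeff_pCons split: nat.splits)
  have "degree h \<le> k"
    unfolding h_def using k by (intro degree_diff_le) (auto simp: degree_monom_eq)
  moreover have "degree h \<ge> k" using co by (intro le_degree) simp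
  ultimately have "degree h = k" by simp
  moreover have "\<forall>i. coeff h i \<in> K" using b by (auto simp: h_def coeff_pCons split: nat.splits)
  moreover have "poly h x \<noteq> 0" if "x \<in> K" for x
    using b(2) that by (auto simp: h_def poly_monom simp del: uminus_eq)
  ultimately show ?thesis using co by blast
qed

section \<open>Sizes of the surfaces and of the parameter space\<close>

lemma card_circle_le: "r \<in> F \<Longrightarrow> card (circle r) \<le> q + 1"
proof (cases "r = 0")
  case True
  then have "circle r \<subseteq> {0}" by (auto simp: circle_def)
  then show ?thesis using card_mono[of "{0}" "circle r"] by simp
qed (simp add: card_circle)

lemma card_surface_le:
  assumes "\<forall>i. coeff h i \<in> K" "\<forall>i. coeff g i \<in> K"
  shows "card (surface h g) \<le> 2 * q ^ 3"
proof -
  have "surface h g = (SIGMA A:K. circle (radius_poly h g A))"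
    by (auto simp: surface_def circle_def)
  then have "card (surface h g) = (\<Sum>A\<in>K. card (circle (radius_poly h g A)))" by simp
  also have "\<dots> \<le> (\<Sum>A\<in>K. q + 1)"
    using assms by (intro sum_mono card_circle_le radius_poly_F poly_K) auto
  also have "\<dots> \<le> q * q * (2 * q)" using q_ge by (simp add: card_K)
  finally show ?thesis by (simp add: power3_eq_cube algebra_simps)
qed

text \<open>A parameter \<open>(c, c', \<rho>, \<alpha>, \<beta>)\<close> describes a circle in each of the two planes, with centres
  \<open>c\<close>, \<open>c'\<close> and radii \<open>\<rho>\<close>, \<open>\<rho>'\<close> summing to \<open>N (c + c')\<close>, and lifts them by the real linear map
  \<open>x \<mapsto> \<alpha> x + \<beta> cj x\<close> and by its inverse adjoint, so that any two lifted points are adjacent.\<close>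

definition params :: "('a \<times> 'a \<times> 'a \<times> 'a \<times> 'a) set" where
  "params = (SIGMA c:K. SIGMA c':K. SIGMA \<rho>:F - {0, N (c + c')}. SIGMA \<alpha>:K. {\<beta> \<in> K. N \<beta> \<noteq> N \<alpha>})"

text \<open>The exponent 9 counts two dimensions over \<open>F\<close> for each of \<open>c\<close>,
  \<open>c'\<close>, \<open>\<alpha>\<close>, \<open>\<beta>\<close> and one for
  \<open>\<rho>\<close>. The excluded values of \<open>\<rho>\<close> and of \<open>\<beta>\<close>
  cost a factor of at most 2 each.\<close>

lemma card_params_ge:
  assumes q: "q \<ge> 4"
  shows "q ^ 9 \<le> 4 * card params"
proof -
  have 1: "card {\<beta> \<in> K. N \<beta> \<noteq> N \<alpha>} \<ge> q * q - (q + 1)" if "\<alpha> \<in> K" for \<alpha>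
  proof -
    have "{\<beta> \<in> K. N \<beta> \<noteq> N \<alpha>} = K - circle (N \<alpha>)" by (auto simp: circle_def)
    then show ?thesis
      using diff_card_le_card_Diff[of "circle (N \<alpha>)" K] card_circle_le[of "N \<alpha>"] that
      by (simp add: card_K)
  qed
  have 2: "card (F - {0, x}) \<ge> q - 2" for x
    using diff_card_le_card_Diff[of "{0, x}" F] card_F card_insert_le_m1[of 2 "{x}" 0] by simp
  have 3: "q * q * (q * q - (q + 1)) \<le> card (SIGMA \<alpha>:K. {\<beta> \<in> K. N \<beta> \<noteq> N \<alpha>})"
  proof -
    have "(\<Sum>\<alpha>\<in>K. q * q - (q + 1)) \<le> (\<Sum>\<alpha>\<in>K. card {\<beta> \<in> K. N \<beta> \<noteq> N \<alpha>})"
      using 1 by (rule sum_mono)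
    then show ?thesis by (simp add: card_K)
  qed
  have 4: "(q - 2) * (q * q * (q * q - (q + 1))) \<le>
      card (SIGMA \<rho>:F - {0, x}. SIGMA \<alpha>:K. {\<beta> \<in> K. N \<beta> \<noteq> N \<alpha>})" for x
    using mult_mono[OF 2 3] by (simp add: card_cartesian_product)
  have "(\<Sum>c\<in>K. \<Sum>c'\<in>K. (q - 2) * (q * q * (q * q - (q + 1)))) \<le>
    (\<Sum>c\<in>K. \<Sum>c'\<in>K. card (SIGMA \<rho>:F - {0, N (c + c')}. SIGMA \<alpha>:K. {\<beta> \<in> K. N \<beta> \<noteq> N \<alpha>}))"
    by (intro sum_mono 4)
  also have "\<dots> = card params"
    unfolding params_def by (simp add: card_SigmaI)
  finally have P: "q * q * (q * q * ((q - 2) * (q * q * (q * q - (q + 1))))) \<le> card params"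
    by (simp add: card_K)
  have "q \<le> 2 * (q - 2)" using q by simp
  moreover have "q * q \<le> 2 * (q * q - (q + 1))"
  proof -
    have "4 * q \<le> q * q" using q by simp
    then show ?thesis using q by linarith
  qed
  ultimately have "q * (q * q * (q * q)) \<le> 2 * (q - 2) * (q * q * (2 * (q * q - (q + 1))))"
    by (rule mult_le_mono[OF _ mult_le_mono2])
  then have "q * q * (q * q * (q * (q * q * (q * q)))) \<le>
      q * q * (q * q * (2 * (q - 2) * (q * q * (2 * (q * q - (q + 1))))))"
    by (intro mult_le_mono2)
  also have "\<dots> = 4 * (q * q * (q * q * ((q - 2) * (q * q * (q * q - (q + 1))))))"
    by simp
  also have "\<dots> \<le> 4 * card params" using P by simp
  finally show ?thesis by (simp add: eval_nat_numeral ac_simps)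
qed

definition lift_fst :: "'a \<Rightarrow> 'a \<Rightarrow> 'a \<Rightarrow> 'a \<Rightarrow> 'a \<Rightarrow> 'a \<times> 'a" where
  "lift_fst c c' \<alpha> \<beta> e = (c + e, \<alpha> * (c + c' + e) + \<beta> * cj (c + c' + e))"

text \<open>The denominator is the determinant of the real linear map used in
  \<open>lift_fst\<close>. With \<open>x = c + c' + e\<close> and \<open>y = c + c' + f\<close>, the
  trace of the product of the two second coordinates becomes \<open>Tr (cj x * y)\<close>.\<close>

definition lift_snd :: "'a \<Rightarrow> 'a \<Rightarrow> 'a \<Rightarrow> 'a \<Rightarrow> 'a \<Rightarrow> 'a \<times> 'a" where
  "lift_snd c c' \<alpha> \<beta> f =
     (c' + f, (cj \<alpha> * cj (c + c' + f) - cj \<beta> * (c + c' + f)) / (N \<alpha> - N \<beta>))"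

text \<open>For \<open>m = c + c'\<close>, the expansion of \<open>Tr (cj (m + e) * (m + f))\<close>
  contains \<open>N m\<close> twice, and \<open>N e + N f = N m\<close> turns one of these into the
  two norms still missing from \<open>N (m + e + f)\<close>.\<close>

lemma adj_lift:
  assumes K: "c \<in> K" "c' \<in> K" "\<alpha> \<in> K" "\<beta> \<in> K" and ab: "N \<beta> \<noteq> N \<alpha>"
    and e: "e \<in> circle \<rho>" and f: "f \<in> circle (N (c + c') - \<rho>)"
  shows "adj (lift_fst c c' \<alpha> \<beta> e) (lift_snd c c' \<alpha> \<beta> f)"
proof -
  define m where "m = c + c'"
  define x where "x = m + e"
  define y where "y = m + f"
  define \<delta> where "\<delta> = N \<alpha> - N \<beta>"
  have ef: "e \<in> K" "N e = \<rho>" "f \<in> K" "N f = N m - \<rho>" using e f by (auto simp: circle_def m_def)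
  have mK: "m \<in> K" using K by (auto simp: m_def)
  have xy: "x \<in> K" "y \<in> K" using mK ef by (auto simp: x_def y_def)
  have \<delta>: "\<delta> \<noteq> 0" "cj \<delta> = \<delta>" using ab K by (auto simp: \<delta>_def simp del: uminus_eq)
  let ?C = "\<alpha> * x + \<beta> * cj x" and ?D = "(cj \<alpha> * cj y - cj \<beta> * y) / \<delta>"
  have "cj ?D = (\<alpha> * y - \<beta> * cj y) / \<delta>" "cj ?C = cj \<alpha> * cj x + cj \<beta> * x" using K xy \<delta> by simp_all
  then have "Tr (?C * ?D) = ((\<alpha> * x + \<beta> * cj x) * (cj \<alpha> * cj y - cj \<beta> * y)
      + (cj \<alpha> * cj x + cj \<beta> * x) * (\<alpha> * y - \<beta> * cj y)) / \<delta>"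
    unfolding Tr_def cj_mult by (simp only: add_divide_distrib times_divide_eq_right)
  also have "(\<alpha> * x + \<beta> * cj x) * (cj \<alpha> * cj y - cj \<beta> * y)
      + (cj \<alpha> * cj x + cj \<beta> * x) * (\<alpha> * y - \<beta> * cj y) = \<delta> * (cj x * y + x * cj y)"
    unfolding \<delta>_def N_def by (simp add: algebra_simps del: uminus_eq)
  also have "\<dots> / \<delta> = cj x * y + x * cj y" using \<delta> by simp
  also have "\<dots> = (m * cj m + (N e + N f)) + cj m * f + m * cj f + cj e * m + e * cj m + cj e * f + e * cj f"
    unfolding x_def y_def ef by (simp add: N_def algebra_simps del: uminus_eq)
  also have "\<dots> = N (m + e + f)" by (simp add: N_def algebra_simps del: uminus_eq)
  finally have "N (m + e + f) = Tr (?C * ?D)" by simp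
  moreover have "c + e + (c' + f) = m + e + f" by (simp add: m_def algebra_simps)
  moreover have "lift_fst c c' \<alpha> \<beta> e = (c + e, ?C)" "lift_snd c c' \<alpha> \<beta> f = (c' + f, ?D)"
    by (simp_all add: lift_fst_def lift_snd_def x_def y_def m_def \<delta>_def del: uminus_eq)
  ultimately show ?thesis by (simp only: adj.simps)
qed

text \<open>Three points determine the base circle, and then the affine function on it, hence
  \<open>\<alpha>\<close>, \<open>\<beta>\<close> and the constant term. As the norms of
  \<open>\<alpha>\<close> and \<open>\<beta>\<close> differ, the linear map is injective and the
  constant term determines \<open>c'\<close>.\<close>

lemma lift_fst_unique:
  assumes K: "c \<in> K" "c' \<in> K" "c2 \<in> K" "c2' \<in> K" and ab: "N \<beta> \<noteq> N \<alpha>"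
    and S: "card S \<ge> 3" "S \<subseteq> lift_fst c c' \<alpha> \<beta> ` circle \<rho>" "S \<subseteq> lift_fst c2 c2' \<alpha>2 \<beta>2 ` circle \<rho>2"
  shows "c = c2 \<and> c' = c2' \<and> \<rho> = \<rho>2 \<and> \<alpha> = \<alpha>2 \<and> \<beta> = \<beta>2"
proof -
  obtain T where T: "T \<subseteq> circle \<rho>" "S = lift_fst c c' \<alpha> \<beta> ` T" using S(2) by (auto simp: subset_image_iff)
  have "card S \<le> card T"
    unfolding T(2) by (rule card_image_le) (rule finite_subset[OF T(1) finite_circle])
  with S(1) have T3: "card T \<ge> 3" by simp
  have ex: "\<exists>e2\<in>circle \<rho>2. lift_fst c c' \<alpha> \<beta> e = lift_fst c2 c2' \<alpha>2 \<beta>2 e2" if "e \<in> T" for e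
    using S(3) T(2) that by blast
  define z where "z = c - c2"
  have "cj z * e + z * cj e + (\<rho> + N z - \<rho>2) = 0" if eT: "e \<in> T" for e
  proof -
    obtain e2 where e2: "e2 \<in> circle \<rho>2" "c + e = c2 + e2"
      using ex[OF eT] by (auto simp: lift_fst_def)
    then have "e2 = e + z" by (simp add: z_def algebra_simps del: uminus_eq)
    then have "N (e + z) = \<rho>2" using e2 by (simp add: circle_def)
    moreover have "N e = \<rho>" using eT T by (auto simp: circle_def)
    ultimately show ?thesis by (simp add: N_def algebra_simps del: uminus_eq)
  qed
  from three_points_on_circle[OF T3 T(1) this] have "z = 0" "\<rho> = \<rho>2" by auto
  then have c: "c = c2" by (simp add: z_def del: uminus_eq)
  have "(\<alpha> - \<alpha>2) * e + (\<beta> - \<beta>2) * cj e +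
      (\<alpha> * (c + c') + \<beta> * cj (c + c') - (\<alpha>2 * (c + c2') + \<beta>2 * cj (c + c2'))) = 0" if eT: "e \<in> T" for e
  proof -
    obtain e2 where "lift_fst c c' \<alpha> \<beta> e = lift_fst c2 c2' \<alpha>2 \<beta>2 e2" using ex[OF eT] by auto
    then have "\<alpha> * (c + c' + e) + \<beta> * cj (c + c' + e) = \<alpha>2 * (c + c2' + e) + \<beta>2 * cj (c + c2' + e)"
      unfolding lift_fst_def c[symmetric] by auto
    then show ?thesis by (simp add: algebra_simps del: uminus_eq)
  qed
  from three_points_on_circle[OF T3 T(1) this]
  have *: "\<alpha> = \<alpha>2" "\<beta> = \<beta>2" "\<alpha> * (c + c') + \<beta> * cj (c + c') = \<alpha>2 * (c + c2') + \<beta>2 * cj (c + c2')"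
    unfolding right_minus_eq by blast+
  have "\<alpha> * (c' - c2') + \<beta> * cj (c' - c2') =
      (\<alpha> * (c + c') + \<beta> * cj (c + c')) - (\<alpha> * (c + c2') + \<beta> * cj (c + c2'))"
    by (simp add: algebra_simps del: uminus_eq)
  also have "\<alpha> * (c + c') + \<beta> * cj (c + c') = \<alpha> * (c + c2') + \<beta> * cj (c + c2')"
    using *(3) unfolding *(1,2)[symmetric] .
  finally have "\<alpha> * (c' - c2') + \<beta> * cj (c' - c2') = 0" by (simp only: diff_self)
  then have "\<alpha> * (c' - c2') = - (\<beta> * cj (c' - c2'))" by (simp only: add_eq_0_iff2)
  from arg_cong[OF this, of N] have "N \<alpha> * N (c' - c2') = N \<beta> * N (cj (c' - c2'))"
    by (simp only: N_simps)
  also have "N (cj (c' - c2')) = N (c' - c2')" by (rule N_cj) (use K in blast)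
  finally have "N (c' - c2') = 0" using ab by (metis mult_right_cancel)
  then have "c' - c2' = 0" by (simp only: N_simps)
  with * c \<open>\<rho> = \<rho>2\<close> show ?thesis by (simp del: uminus_eq)
qed

text \<open>The factor 4 is the loss in \<open>card_params_ge\<close>, and the square is the price
  of choosing \<open>g1\<close> and \<open>g2\<close> independently, one for each surface. The two
  surfaces have at most \<open>4 * q ^ 3\<close> points together.\<close>

lemma gen_turan_lower:
  assumes k: "k \<ge> 3" and q: "q \<ge> 8 * k" and ab: "3 \<le> a" "a \<le> 2 * k" "b \<le> 2 * k" and t: "t \<ge> 2 * k + 1"
    and n: "n \<ge> 4 * q ^ 3"
  shows "q ^ 9 \<le> 4 * ((4 * k) ^ (2 * k - 1)) ^ 2 *
    gen_turan n (complete_bipartite a b) (complete_bipartite 3 t)"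
proof -
  have "k \<ge> 2" using k by simp
  then obtain h where "degree h = k \<and> lead_coeff h = 1 \<and> (\<forall>i. coeff h i \<in> K) \<and> (\<forall>x\<in>K. poly h x \<noteq> 0)"
    using ex_rootless_poly by blast
  then have h: "degree h = k" "lead_coeff h = 1" "\<forall>i. coeff h i \<in> K" "\<And>x. x \<in> K \<Longrightarrow> poly h x \<noteq> 0"
    by blast+
  define M where "M = (4 * k) ^ (2 * k - 1)"
  \<comment> \<open>The last three arguments of \<open>circle_zeros\<close> are the coefficients of
    the lifted second coordinate as an affine function on the circle, so these are the points whose
    lifts land on the surface.\<close>
  define Z1 where "Z1 = (\<lambda>(c, c', \<rho>, \<alpha>, \<beta>). circle_zeros h c \<rho> (\<alpha> * (c + c') + \<beta> * cj (c + c')) \<alpha> \<beta>)"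
  define Z2 where "Z2 = (\<lambda>(c, c', \<rho>, \<alpha>, \<beta>). circle_zeros h c' (N (c + c') - \<rho>)
     ((cj \<alpha> * cj (c + c') - cj \<beta> * (c + c')) / (N \<alpha> - N \<beta>))
     (- cj \<beta> / (N \<alpha> - N \<beta>)) (cj \<alpha> / (N \<alpha> - N \<beta>)))"
  define good1 where "good1 p = {g \<in> polys k. card (Z1 p g) \<ge> 2 * k}" for p
  define good2 where "good2 p = {g \<in> polys k. card (Z2 p g) \<ge> 2 * k}" for p
  define good where "good gg = {p \<in> params. fst gg \<in> good1 p \<and> snd gg \<in> good2 p}" for gg
  have k0: "k > 0" using k by simp
  note finP = finite_polys[OF k0] and cardP = card_polys[OF k0]
  have fing: "finite (good1 p)" "finite (good2 p)" for p using finP by (auto simp: good1_def good2_def)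
  have finpar: "finite params" unfolding params_def by (intro finite_SigmaI) auto
  have cg: "q ^ (2 * k) \<le> card (good1 p) * M" "q ^ (2 * k) \<le> card (good2 p) * M" if "p \<in> params" for p
  proof -
    obtain c c' \<rho> \<alpha> \<beta> where p: "p = (c, c', \<rho>, \<alpha>, \<beta>)" by (cases p)
    have K: "c \<in> K" "c' \<in> K" "\<alpha> \<in> K" "\<beta> \<in> K" "\<rho> \<in> F" "\<rho> \<noteq> 0" "\<rho> \<noteq> N (c + c')"
      using that by (auto simp: p params_def)
    have m: "c + c' \<in> K" "cj (c + c') \<in> K" "cj \<alpha> \<in> K" "cj \<beta> \<in> K" "N \<alpha> - N \<beta> \<in> K" "\<rho> \<in> K"
      using K by blast+
    have \<rho>': "N (c + c') - \<rho> \<noteq> 0" "N (c + c') - \<rho> \<in> F" using K m by (auto simp del: uminus_eq)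
    show "q ^ (2 * k) \<le> card (good1 p) * M"
      unfolding good1_def M_def Z1_def p prod.case
      using K m by (intro card_many_zeros[OF h(1-3) h(4) k _ _ _ _ _ _ q]) blast+
    show "q ^ (2 * k) \<le> card (good2 p) * M"
      unfolding good2_def M_def Z2_def p prod.case
      using K m by (intro card_many_zeros[OF h(1-3) h(4) k \<rho>' _ _ _ _ q]) blast+
  qed
  \<comment> \<open>Averaging: each parameter is good for at least a share \<open>1 / M ^ 2\<close>
    of the pairs of polynomials, so some pair is good for at least that share of the
    parameters.\<close>
  have "\<exists>gg\<in>polys k \<times> polys k. card params \<le> M ^ 2 * card (good gg)"
  proof (rule ccontr)
    assume no: "\<not> (\<exists>gg\<in>polys k \<times> polys k. card params \<le> M ^ 2 * card (good gg))"
    have ne: "polys k \<times> polys k \<noteq> {}"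
    proof -
      have "card (polys k \<times> polys k) > 0" using q_ge by (simp add: cardP card_cartesian_product)
      then show ?thesis by (metis card.empty less_numeral_extra(3))
    qed
    have "card params * (q ^ (2 * k) * q ^ (2 * k)) = (\<Sum>p\<in>params. q ^ (2 * k) * q ^ (2 * k))" by simp
    also have "\<dots> \<le> (\<Sum>p\<in>params. M ^ 2 * card (good1 p \<times> good2 p))"
    proof (rule sum_mono)
      fix p assume "p \<in> params"
      then have "q ^ (2 * k) * q ^ (2 * k) \<le> (card (good1 p) * M) * (card (good2 p) * M)"
        using cg by (intro mult_le_mono) auto
      then show "q ^ (2 * k) * q ^ (2 * k) \<le> M ^ 2 * card (good1 p \<times> good2 p)"
        by (simp add: card_cartesian_product power2_eq_square mult_ac)
    qed
    also have "\<dots> = M ^ 2 * (\<Sum>p\<in>params. card (good1 p \<times> good2 p))" by (simp add: sum_distrib_left)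
    also have "(\<Sum>p\<in>params. card (good1 p \<times> good2 p)) = (\<Sum>gg\<in>polys k \<times> polys k. card (good gg))"
    proof -
      have "(\<Sum>p\<in>params. card (good1 p \<times> good2 p)) =
          (\<Sum>p\<in>params. card {gg \<in> polys k \<times> polys k. fst gg \<in> good1 p \<and> snd gg \<in> good2 p})"
        by (intro sum.cong refl arg_cong[of _ _ card]) (auto simp: good1_def good2_def)
      also have "\<dots> = (\<Sum>gg\<in>polys k \<times> polys k. card (good gg))"
        unfolding good_def using finpar finP by (intro sum_multicount_gen) auto
      finally show ?thesis .
    qed
    also have "M ^ 2 * \<dots> = (\<Sum>gg\<in>polys k \<times> polys k. M ^ 2 * card (good gg))" by (simp add: sum_distrib_left)
    also have "\<dots> < (\<Sum>gg\<in>polys k \<times> polys k. card params)"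
    proof (rule sum_strict_mono)
      fix gg assume "gg \<in> polys k \<times> polys k"
      then show "M ^ 2 * card (good gg) < card params" using no by (meson not_le)
    qed (use finP ne in auto)
    also have "\<dots> = card params * (q ^ (2 * k) * q ^ (2 * k))"
      by (simp add: cardP card_cartesian_product)
    finally show False by simp
  qed
  then obtain g1 g2 where g: "g1 \<in> polys k" "g2 \<in> polys k" and many: "card params \<le> M ^ 2 * card (good (g1, g2))"
    by auto
  have gd: "degree g1 < k" "degree g2 < k" "\<forall>i. coeff g1 i \<in> K" "\<forall>i. coeff g2 i \<in> K"
    using g by (auto simp: polys_def)
  define XS where "XS = (\<lambda>(c, c', \<rho>, \<alpha>, \<beta>). lift_fst c c' \<alpha> \<beta> ` Z1 (c, c', \<rho>, \<alpha>, \<beta>) g1)"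
  define YS where "YS = (\<lambda>(c, c', \<rho>, \<alpha>, \<beta>). lift_snd c c' \<alpha> \<beta> ` Z2 (c, c', \<rho>, \<alpha>, \<beta>) g2)"
  have XY: "XS p \<subseteq> surface h g1" "YS p \<subseteq> surface h g2" "card (XS p) \<ge> 2 * k" "card (YS p) \<ge> 2 * k"
    "\<forall>x\<in>XS p. \<forall>y\<in>YS p. adj x y" if "p \<in> good (g1, g2)" for p
  proof -
    obtain c c' \<rho> \<alpha> \<beta> where p: "p = (c, c', \<rho>, \<alpha>, \<beta>)" by (cases p)
    have K: "c \<in> K" "c' \<in> K" "\<alpha> \<in> K" "\<beta> \<in> K" "N \<beta> \<noteq> N \<alpha>"
      using that by (auto simp: p params_def good_def)
    have Z: "Z1 p g1 \<subseteq> circle \<rho>" "Z2 p g2 \<subseteq> circle (N (c + c') - \<rho>)"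
      by (auto simp: Z1_def Z2_def circle_zeros_def p)
    have zK: "e \<in> K" if "e \<in> circle r" for e r using that by (simp add: circle_def)
    have mK: "c + c' \<in> K" using K by blast
    show "XS p \<subseteq> surface h g1"
    proof -
      have "lift_fst c c' \<alpha> \<beta> e \<in> surface h g1" if e: "e \<in> Z1 p g1" for e
      proof -
        have eK: "e \<in> K" using e Z zK by blast
        have "\<alpha> * (c + c' + e) + \<beta> * cj (c + c' + e) = \<alpha> * (c + c') + \<beta> * cj (c + c') + \<alpha> * e + \<beta> * cj e"
          by (simp add: algebra_simps)
        then have "N (\<alpha> * (c + c' + e) + \<beta> * cj (c + c' + e)) = radius_poly h g1 (c + e)"
          using e by (simp add: Z1_def p circle_zeros_def)
        moreover have "c + e \<in> K" "\<alpha> * (c + c' + e) + \<beta> * cj (c + c' + e) \<in> K" using K eK by blast+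
        ultimately show ?thesis unfolding surface_def lift_fst_def by blast
      qed
      then show ?thesis unfolding XS_def p by auto
    qed
    show "YS p \<subseteq> surface h g2"
    proof -
      have "lift_snd c c' \<alpha> \<beta> e \<in> surface h g2" if e: "e \<in> Z2 p g2" for e
      proof -
        have eK: "e \<in> K" using e Z zK by blast
        have "(cj \<alpha> * cj (c + c' + e) - cj \<beta> * (c + c' + e)) / (N \<alpha> - N \<beta>) =
            (cj \<alpha> * cj (c + c') - cj \<beta> * (c + c')) / (N \<alpha> - N \<beta>) + - cj \<beta> / (N \<alpha> - N \<beta>) * e + cj \<alpha> / (N \<alpha> - N \<beta>) * cj e"
          (is "?D = ?E")
        proof -
          have "cj \<alpha> * cj (c + c' + e) - cj \<beta> * (c + c' + e) =
              (cj \<alpha> * cj (c + c') - cj \<beta> * (c + c')) + - cj \<beta> * e + cj \<alpha> * cj e"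
            by (simp add: algebra_simps del: uminus_eq)
          then show ?thesis by (simp only: add_divide_distrib times_divide_eq_left)
        qed
        moreover have "N ?E = radius_poly h g2 (c' + e)"
          using e by (simp add: Z2_def p circle_zeros_def del: uminus_eq)
        moreover have "c' + e \<in> K" "?D \<in> K" using K eK by blast+
        ultimately show ?thesis unfolding surface_def lift_snd_def by simp
      qed
      then show ?thesis unfolding YS_def p by auto
    qed
    have "inj_on (lift_fst c c' \<alpha> \<beta>) A" "inj_on (lift_snd c c' \<alpha> \<beta>) A" for A
      by (auto simp: inj_on_def lift_fst_def lift_snd_def)
    then show "card (XS p) \<ge> 2 * k" "card (YS p) \<ge> 2 * k"
      using that unfolding XS_def YS_def p good_def good1_def good2_def by (auto simp: card_image)
    show "\<forall>x\<in>XS p. \<forall>y\<in>YS p. adj x y"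
      using adj_lift[OF K] Z unfolding XS_def YS_def p by blast
  qed
  \<comment> \<open>One pair of vertex sets is chosen for each parameter. Its first set has at least
    three points on the lifted circle and so determines the parameter by
    \<open>lift_fst_unique\<close>.\<close>
  define sel where "sel p = (SOME PQ. fst PQ \<subseteq> XS p \<and> snd PQ \<subseteq> YS p \<and> card (fst PQ) = a \<and> card (snd PQ) = b)" for p
  have sel: "fst (sel p) \<subseteq> XS p \<and> snd (sel p) \<subseteq> YS p \<and> card (fst (sel p)) = a \<and> card (snd (sel p)) = b"
    if p: "p \<in> good (g1, g2)" for p
  proof -
    obtain P Q where "P \<subseteq> XS p" "card P = a" "Q \<subseteq> YS p" "card Q = b"
      using obtain_subset_with_card_n[of a "XS p"] obtain_subset_with_card_n[of b "YS p"] XY(3,4)[OF p] ab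
      by (metis le_trans)
    then have "\<exists>PQ. fst PQ \<subseteq> XS p \<and> snd PQ \<subseteq> YS p \<and> card (fst PQ) = a \<and> card (snd PQ) = b"
      by (intro exI[of _ "(P, Q)"]) simp
    then show ?thesis unfolding sel_def by (rule someI_ex)
  qed
  have inj: "inj_on sel (good (g1, g2))"
  proof (rule inj_onI)
    fix p p2 assume pp: "p \<in> good (g1, g2)" "p2 \<in> good (g1, g2)" "sel p = sel p2"
    obtain c c' \<rho> \<alpha> \<beta> where p: "p = (c, c', \<rho>, \<alpha>, \<beta>)" by (cases p)
    obtain c2 c2' \<rho>2 \<alpha>2 \<beta>2 where p2: "p2 = (c2, c2', \<rho>2, \<alpha>2, \<beta>2)" by (cases p2)
    have K: "c \<in> K" "c' \<in> K" "c2 \<in> K" "c2' \<in> K" "N \<beta> \<noteq> N \<alpha>"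
      using pp by (auto simp: p p2 params_def good_def)
    have "card (fst (sel p)) \<ge> 3" using sel[OF pp(1)] ab by simp
    moreover have "fst (sel p) \<subseteq> lift_fst c c' \<alpha> \<beta> ` circle \<rho>"
      using sel[OF pp(1)] by (auto simp: XS_def Z1_def circle_zeros_def p)
    moreover have "fst (sel p) \<subseteq> lift_fst c2 c2' \<alpha>2 \<beta>2 ` circle \<rho>2"
      using sel[OF pp(2)] unfolding pp(3) by (auto simp: XS_def Z1_def circle_zeros_def p2)
    ultimately show "p = p2" unfolding p p2 using lift_fst_unique[OF K] by blast
  qed
  have "card (sel ` good (g1, g2)) \<le> gen_turan n (complete_bipartite a b) (complete_bipartite 3 t)"
  proof (rule gen_turan_ge_incidence[of "surface h g1" "surface h g2" n t adj])
    show "card (surface h g1) + card (surface h g2) \<le> n"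
      using card_surface_le[OF h(3) gd(3)] card_surface_le[OF h(3) gd(4)] n by simp
    have 3: "card {y \<in> surface h g'. \<forall>x\<in>P. adj x y} < t"
      if "P \<subseteq> surface h g" "card P = 3" "degree g' < k" for P g g'
    proof -
      obtain x1 x2 x3 where P: "P = {x1, x2, x3}" "x1 \<noteq> x2" "x1 \<noteq> x3" "x2 \<noteq> x3"
        using \<open>card P = 3\<close> by (auto simp: card_3_iff)
      have "card (common h g' x1 x2 x3) \<le> 2 * k"
        using P that(1) by (intro card_common_le[OF h(1,2,4) that(3) k, where h' = h and g' = g]) auto
      moreover have "{y \<in> surface h g'. \<forall>x\<in>P. adj x y} = common h g' x1 x2 x3"
        unfolding P common_def by auto
      ultimately show ?thesis using t by simp
    qed
    show "card {y \<in> surface h g2. \<forall>x\<in>P. adj x y} < t" if "P \<subseteq> surface h g1" "card P = 3" for P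
      using 3[OF that gd(2)] .
    show "card {x \<in> surface h g1. \<forall>y\<in>Q. adj x y} < t" if "Q \<subseteq> surface h g2" "card Q = 3" for Q
      using 3[OF that gd(1)] by (simp add: adj_commute)
    show "P \<subseteq> surface h g1 \<and> Q \<subseteq> surface h g2 \<and> card P = a \<and> card Q = b \<and> (\<forall>x\<in>P. \<forall>y\<in>Q. adj x y)"
      if PQ: "(P, Q) \<in> sel ` good (g1, g2)" for P Q
    proof -
      from PQ obtain p where p: "(P, Q) = sel p" "p \<in> good (g1, g2)" by (rule imageE)
      show ?thesis using sel[OF p(2)] XY[OF p(2)] unfolding p(1)[symmetric] fst_conv snd_conv by blast
    qed
  qed (use t in auto)
  then have "card (good (g1, g2)) \<le> gen_turan n (complete_bipartite a b) (complete_bipartite 3 t)"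
    by (simp add: card_image[OF inj])
  then have "card params \<le> M ^ 2 * gen_turan n (complete_bipartite a b) (complete_bipartite 3 t)"
    using many by (meson le_trans mult_le_mono2)
  moreover have "q ^ 9 \<le> 4 * card params" using card_params_ge q k by simp
  ultimately show ?thesis unfolding M_def[symmetric] by simp
qed

end

section \<open>Finite fields of characteristic two\<close>

text \<open>Over an algebraically closed field the multiset of roots has size
  \<open>degree p\<close>, and a multiple root would also be a root of the derivative.\<close>

lemma card_roots_separable:
  fixes p :: "'a::alg_closed_field poly"
  assumes p: "p \<noteq> 0" and sep: "\<And>x. poly p x = 0 \<Longrightarrow> poly (pderiv p) x \<noteq> 0"
  shows "card {x. poly p x = 0} = degree p"
proof -
  obtain A where A: "size A = degree p" "p = smult (lead_coeff p) (\<Prod>x\<in>#A. [:-x, 1:])"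
    using alg_closed_imp_factorization[OF p] by blast
  have "proots (\<Prod>x\<in>#A. [:-x, 1:]) = A"
  proof (induction A)
    case (add x A)
    have "(\<Prod>x\<in>#A. [:-x, 1::'a:]) \<noteq> 0" by (auto simp: prod_mset_zero_iff)
    then have "proots ([:-x, 1:] * (\<Prod>x\<in>#A. [:-x, 1:])) = {#x#} + A"
      using add.IH by (subst proots_mult) auto
    then show ?case by (simp del: mult_pCons_left)
  qed simp
  then have "proots p = A" using p by (subst A(2), subst proots_smult) auto
  then have roots: "set_mset A = {x. poly p x = 0}" and cnt: "count A x = order x p" for x
    using p by (auto simp flip: \<open>proots p = A\<close>)
  have "count A x = 1" if "x \<in># A" for x
  proof (rule ccontr)
    assume "count A x \<noteq> 1"
    moreover have "count A x > 0" using that by simp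
    ultimately have "2 \<le> order x p" unfolding cnt by linarith
    then have "[:-x, 1:] ^ 2 dvd p" using order_1[of x p] by (rule power_le_dvd[rotated])
    then obtain s where s: "p = [:-x, 1:] ^ 2 * s" by (rule dvdE)
    have "poly (pderiv p) x = 0"
      unfolding s power2_eq_square pderiv_mult by simp
    moreover have "poly p x = 0" using that roots by auto
    ultimately show False using sep by blast
  qed
  then have "size A = card (set_mset A)"
    by (simp add: size_multiset_overloaded_eq)
  then show ?thesis using A(1) roots by simp
qed

text \<open>Since \<open>n\<close> vanishes in the field, the derivative of \<open>x ^ n - x\<close>
  is the constant -1 and all roots are simple.\<close>

lemma card_power_fixed:
  assumes n: "n \<ge> 2" "of_nat n = (0::'a::alg_closed_field)"
  shows "card {x::'a. x ^ n = x} = n"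
proof -
  let ?p = "monom 1 n - monom (1::'a) 1"
  have deg: "degree ?p = n"
    unfolding diff_conv_add_uminus using n by (subst degree_add_eq_left) (simp_all add: degree_monom_eq)
  have "card {x. poly ?p x = 0} = degree ?p"
    using n deg by (intro card_roots_separable) (auto simp: pderiv_diff pderiv_monom poly_monom)
  then show ?thesis unfolding deg by (simp add: poly_monom)
qed

text \<open>The derivative of \<open>x ^ (n + 1) - r\<close> vanishes only at 0, which is not a
  root.\<close>

lemma card_power_eq:
  assumes n: "of_nat (Suc n) \<noteq> (0::'a::alg_closed_field)" and r: "r \<noteq> (0::'a)" and "n > 0"
  shows "card {x::'a. x * x ^ n = r} = Suc n"
proof -
  let ?p = "monom 1 (Suc n) - [:r:]"
  have deg: "degree ?p = Suc n"
    unfolding diff_conv_add_uminus by (subst degree_add_eq_left) (simp_all add: degree_monom_eq)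
  have "card {x. poly ?p x = 0} = degree ?p"
  proof (rule card_roots_separable)
    show "?p \<noteq> 0" using deg by auto
    fix x assume "poly ?p x = 0"
    then have "x \<noteq> 0" using r by (auto simp: poly_monom)
    then show "poly (pderiv ?p) x \<noteq> 0"
      using n by (simp add: pderiv_diff pderiv_monom pderiv_pCons poly_monom del: of_nat_Suc)
  qed
  then show ?thesis unfolding deg by (simp add: poly_monom)
qed

text \<open>For all \<open>j\<close> these fields lie in one algebraic closure of the field with two
  elements. There \<open>2 ^ j\<close> and its square are zero and \<open>2 ^ j + 1\<close> is 1, as
  the separability arguments require.\<close>

lemma quadratic_field_alg_closure:
  assumes "j > 0"
  shows "quadratic_field (2 ^ j) {x :: bit alg_closure. x ^ (2 ^ j * 2 ^ j) = x}"
proof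
  have "to_ac (2::bit) = 2" by (rule to_ac_numeral)
  then show two: "(2 :: bit alg_closure) = 0" by simp
  have even: "of_nat (2 ^ m) = (0 :: bit alg_closure)" if "m > 0" for m
    using two that by (simp add: power_0_left)
  have q: "(2::nat) ^ j \<ge> 2" using assms self_le_power[of 2 j] by simp
  then show "2 \<le> (2::nat) ^ j" .
  show "(x + y) ^ 2 ^ j = x ^ 2 ^ j + y ^ 2 ^ j" for x y :: "bit alg_closure"
  proof (induction j)
    case (Suc j)
    have "(x + y) ^ 2 ^ Suc j = ((x + y) ^ 2 ^ j) ^ 2"
      by (simp add: mult.commute flip: power_mult)
    also have "\<dots> = (x ^ 2 ^ j) ^ 2 + (y ^ 2 ^ j) ^ 2"
      unfolding Suc.IH power2_sum two by simp
    finally show ?case by (simp add: mult.commute flip: power_mult)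
  qed simp
  show "card {x :: bit alg_closure. x ^ (2 ^ j * 2 ^ j) = x} = 2 ^ j * 2 ^ j"
    using q even[of "j + j"] assms mult_le_mono[of 2 "2 ^ j" 1 "2 ^ j"]
    by (intro card_power_fixed) (auto simp: power_add)
  show "card {x :: bit alg_closure. x ^ 2 ^ j = x} = 2 ^ j"
    using q even[OF assms] by (intro card_power_fixed)
  have "of_nat (Suc (2 ^ j)) = (1 :: bit alg_closure)"
    by (simp only: of_nat_Suc even[OF assms] add_0_right)
  then have "of_nat (Suc (2 ^ j)) \<noteq> (0 :: bit alg_closure)" by (simp only: one_neq_zero not_False_eq_True)
  then show "card {x :: bit alg_closure. x * x ^ 2 ^ j = r} = 2 ^ j + 1" if "r \<noteq> 0" for r
    using card_power_eq[of "2 ^ j" r, OF _ that] by (simp del: of_nat_Suc)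
qed (rule refl)

section \<open>Choice of the field order and the constants\<close>

theorem theorem1p2:
  fixes a b t :: nat
  assumes "3 < a" and "a \<le> b" and "t \<ge> tau b"
  shows "\<exists>(c::real) (C::real) (n0::nat). c > 0 \<and> C > 0 \<and>
    (\<forall>n\<ge>n0.
      c * real n ^ 3 \<le> real (gen_turan n (complete_bipartite a b) (complete_bipartite 3 t)) \<and>
      real (gen_turan n (complete_bipartite a b) (complete_bipartite 3 t)) \<le> C * real n ^ 3)"
proof -
  define k where "k = max 3 (nat \<lceil>real b / 2\<rceil>)"
  have k: "k \<ge> 3" "b \<le> 2 * k" and t: "t \<ge> 2 * k + 1"
    using assms(3) unfolding k_def tau_def by linarith+
  define M where "M = 4 * ((4 * k) ^ (2 * k - 1)) ^ 2"
  \<comment> \<open>\<open>n < 32 * q ^ 3\<close> and \<open>q ^ 9 \<le> M * ?T n\<close> will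
    combine to \<open>n ^ 3 \<le> 32 ^ 3 * M * ?T n\<close>.\<close>
  define c where "c = 1 / (32 ^ 3 * real M)"
  let ?T = "\<lambda>n. gen_turan n (complete_bipartite a b) (complete_bipartite 3 t)"
  have M: "M > 0" using k by (simp add: M_def)
  have upper: "real (?T n) \<le> 4 ^ t * real n ^ 3" for n
  proof -
    have "?T n \<le> 4 ^ t * n ^ 3"
      using assms t card_copies_complete_bipartite_le[of _ t a b]
      by (intro gen_turan_le parcs_complete_bipartite_nonempty) auto
    then have "real (?T n) \<le> real (4 ^ t * n ^ 3)" by (simp only: of_nat_le_iff)
    then show ?thesis by simp
  qed
  have lower: "c * real n ^ 3 \<le> real (?T n)" if n: "n \<ge> 32 * (8 * k) ^ 3" for n
  proof -
    have "1 \<le> k ^ 3" using k by simp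
    then have "1 \<le> n div 4" using n by (simp add: power_mult_distrib)
    \<comment> \<open>\<open>2 ^ j\<close> is the largest power of two \<open>q\<close> with
      \<open>4 * q ^ 3 \<le> n\<close>; doubling it multiplies the cube by 8, whence
      \<open>n < 32 * q ^ 3\<close>. The bound on \<open>n\<close> then yields
      \<open>8 * k < q\<close>.\<close>
    then obtain j where j: "8 ^ j \<le> n div 4" "n div 4 < 8 ^ (j + 1)"
      using ex_power_ivl1[of 8 "n div 4"] by auto
    define q where "q = (2::nat) ^ j"
    have "q ^ 3 = (2 ^ 3) ^ j" unfolding q_def by (simp only: power_mult[symmetric] mult.commute)
    then have q3: "q ^ 3 = 8 ^ j" by simp
    have n1: "4 * q ^ 3 \<le> n" and n2: "n < 32 * q ^ 3" using j unfolding q3 by auto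
    have "(8 * k) ^ 3 < q ^ 3" using n n2 by linarith
    then have q: "8 * k < q" by (rule power_less_imp_less_base) simp
    have "j > 0" using q k unfolding q_def by (cases j) auto
    then interpret quadratic_field q "{x :: bit alg_closure. x ^ (q * q) = x}"
      unfolding q_def by (rule quadratic_field_alg_closure)
    have "q ^ 9 \<le> M * ?T n"
      unfolding M_def using gen_turan_lower[of k a b t n] k q assms t n1 by simp
    moreover have "n ^ 3 \<le> (32 * q ^ 3) ^ 3" using n2 by (intro power_mono) auto
    moreover have "(32 * q ^ 3) ^ 3 = 32 ^ 3 * q ^ 9" by (simp add: power_mult_distrib flip: power_mult)
    ultimately have "n ^ 3 \<le> 32 ^ 3 * (M * ?T n)" by (metis le_trans mult_le_mono2)
    then have "real (n ^ 3) \<le> real (32 ^ 3 * (M * ?T n))" by (simp only: of_nat_le_iff)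
    then show ?thesis using M unfolding c_def by (simp add: field_simps)
  qed
  show ?thesis
    using upper lower M by (intro exI[of _ c] exI[of _ "4 ^ t"] exI[of _ "32 * (8 * k) ^ 3"]) (simp add: c_def)
qed

end
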